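(* There exist constants $c_\alpha, c_\eta>0$ such that, when the (positive) step sizes $\alpha_k$, $\beta$ and $\eta_k$ of gMOBA are chosen as constants satisfying $$\alpha_k=\alpha\le\min\left\{c_\alpha,\ \frac{\mu}{4L_{f_y}^2}\,\eta_k,\ \frac{\mu^7}{16L_v^2}\,\eta_k\right\},\qquad \beta\le\frac{2}{\mu+L_{f_y}},\qquad \eta_k=\eta\le c_\eta,$$ any limit point of the sequence $\{x^k\}$ generated by gMOBA is Pareto stationary for the multi-objective bi-level problem $\min_{x\in\mathcal X,\,y\in\mathbb R^{n_2}}(F_1(x,y)+g_1(x),\ldots,F_m(x,y)+g_m(x))$ subject to $y\in\operatorname{argmin}_{y'\in\mathbb R^{n_2}}f(x,y')$.
   Context: Setting. $\mathcal X\subset\mathbb R^{n_1}$ is a closed convex set; $f(x,y)$, $F_i(x,y)$ and $g_i(x)$, $i=1,\ldots,m$, are real-valued, with $x\in\mathbb R^{n_1}$ and $y\in\mathbb R^{n_2}$. Standing assumptions. (a) For any $x\in\mathcal X$, $f(x,y)$ is $\mu$-strongly convex with respect to $y$, where $\mu>0$. (b) $f$ is twice continuously differentiable with Lipschitz continuous first and second order derivatives on $\mathcal X\times\mathbb R^{n_2}$. (c) For each $i$, $F_i$ is continuously differentiable and bounded below on $\mathcal X\times\mathbb R^{n_2}$, and its first order derivative is Lipschitz continuous and bounded on $\mathcal X\times\mathbb R^{n_2}$. (d) Each $g_i$ is convex and continuous on an open set $\mathcal O\supseteq\mathcal X$. Notation. $y^*(x)=\operatorname{argmin}_{y}f(x,y)$,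 $\varphi_i(x)=F_i(x,y^*(x))$, $\Phi_i=\varphi_i+g_i$, $\Phi=(\Phi_1,\ldots,\Phi_m)$. Here $\nabla_{xy}^2 f$ is the $n_1\times n_2$ matrix with entries $\partial^2 f/\partial x_a\partial y_b$. Constants. $C_{F_y}$ is an upper bound of $\|\nabla_yF_i\|$ on $\mathcal X\times\mathbb R^{n_2}$ for all $i$; $L_{F_y},L_{f_y},L_{f_{yy}}$ are Lipschitz constants on $\mathcal X\times\mathbb R^{n_2}$ of $\nabla_yF_i$ (for all $i$), $\nabla_yf$, $\nabla_{yy}^2f$, respectively; $L_v=C_{F_y}L_{f_{yy}}L_{f_y}+\mu(C_{F_y}L_{f_{yy}}+L_{F_y}L_{f_y})+\mu^2L_{F_y}$. gMOBA. Given initial points $x^0\in\mathcal X$, $y^0\in\mathbb R^{n_2}$, $v_i^0\in\mathbb R^{n_2}$ ($i=1,\ldots,m$) and positive step sizes $\alpha_k,\beta,\eta_k$, for $k=0,1,2,\ldots$: $y^{k+1}=y^k-\beta\nabla_yf(x^k,y^k)$; $v_i^{k+1}=v_i^k-\eta_k d_{v_i}^k$ for $i=1,\ldots,m$, with $d_{v_i}^k=\nabla_{yy}^2f(x^k,y^k)v_i^k-\nabla_yF_i(x^k,y^k)$; $x^{k+1}=\operatorname{argmin}_{x\in\mathcal X}\{\max_{i=1,\ldots,m}h_i^k(x)+\frac{1}{2\alpha_k}\|x-x^k\|^2\}$, where $h_i^k(x)=\langle d_{\varphi_i}^k,x-x^k\rangle+g_i(x)-g_i(x^k)$ and $d_{\varphi_i}^k=\nabla_xF_i(x^k,y^k)-\nabla_{xy}^2f(x^k,y^k)v_i^k$.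 Pareto stationarity. The bi-level problem is equivalent to minimizing $\Phi$ over $x\in\mathcal X$. A point $\bar x\in\mathcal X$ is Pareto stationary if $\max_{i=1,\ldots,m}\Phi_i'(\bar x;d)\ge 0$ for all $d\in\mathbb R^{n_1}$, where $\Phi_i'(\bar x;d)$ is the directional derivative of $\Phi_i$ at $\bar x$ in the direction $d$ and the constraint $x\in\mathcal X$ is incorporated by setting each $\Phi_i$ to $+\infty$ outside $\mathcal X$ (equivalently, the inequality is required for all $d=x-\bar x$ with $x\in\mathcal X$).
   Formalization: The constant c_α is allowed to depend on β (c_η is not); with c_α fixed before β the claim fails, since for β much smaller than α the iterates can oscillate around the only stationary point. *)

theory Defs
  imports "HOL-Analysis.Analysis"
begin

definition gradient :: "('a::euclidean_space \<Rightarrow> real) \<Rightarrow> 'a \<Rightarrow> 'a" where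
  "gradient h z = (\<Sum>b\<in>Basis. frechet_derivative h (at z) b *\<^sub>R b)"

definition grad_x :: "(real^'n1 \<Rightarrow> real^'n2 \<Rightarrow> real) \<Rightarrow> real^'n1 \<Rightarrow> real^'n2 \<Rightarrow> real^'n1" where
  "grad_x h x y = gradient (\<lambda>x'. h x' y) x"

definition grad_y :: "(real^'n1 \<Rightarrow> real^'n2 \<Rightarrow> real) \<Rightarrow> real^'n1 \<Rightarrow> real^'n2 \<Rightarrow> real^'n2" where
  "grad_y h x y = gradient (\<lambda>y'. h x y') y"

definition hess_yy :: "(real^'n1 \<Rightarrow> real^'n2 \<Rightarrow> real) \<Rightarrow> real^'n1 \<Rightarrow> real^'n2 \<Rightarrow> real^'n2^'n2" where
  "hess_yy h x y = jacobian (\<lambda>y'. grad_y h x y') (at y)"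

text \<open>The Jacobian of \<open>x \<mapsto> grad_y h x y\<close> has one row per component of \<open>y\<close>; its transpose
  is the \<open>n1 \<times> n2\<close> matrix with entries \<open>\<partial>\<^sup>2 h / \<partial>x\<^sub>a \<partial>y\<^sub>b\<close>.\<close>

definition hess_xy :: "(real^'n1 \<Rightarrow> real^'n2 \<Rightarrow> real) \<Rightarrow> real^'n1 \<Rightarrow> real^'n2 \<Rightarrow> real^'n2^'n1" where
  "hess_xy h x y = transpose (jacobian (\<lambda>x'. grad_y h x' y) (at x))"

text \<open>Derivatives at points of \<open>S\<close> are derivatives in the whole space.  \<open>S\<close> need not be open,
  so a second derivative on \<open>S\<close> presupposes a first derivative on an open neighbourhood of \<open>S\<close>.
  Second derivatives are compared in the operator norm.\<close>

definition C1_on :: "('a::euclidean_space \<Rightarrow> real) \<Rightarrow> 'a set \<Rightarrow> bool" where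
  "C1_on h S \<longleftrightarrow> (\<forall>z\<in>S. h differentiable at z) \<and> continuous_on S (gradient h)"

definition second_deriv :: "('a::euclidean_space \<Rightarrow> real) \<Rightarrow> 'a \<Rightarrow> 'a \<Rightarrow> 'a" where
  "second_deriv h z = frechet_derivative (gradient h) (at z)"

definition C2_on :: "('a::euclidean_space \<Rightarrow> real) \<Rightarrow> 'a set \<Rightarrow> bool" where
  "C2_on h S \<longleftrightarrow>
     (\<exists>U. open U \<and> S \<subseteq> U \<and> (\<forall>z\<in>U. h differentiable at z)) \<and>
     (\<forall>z\<in>S. gradient h differentiable at z) \<and>
     (\<forall>d. continuous_on S (\<lambda>z. second_deriv h z d))"

definition lipschitz_second_deriv_on :: "real \<Rightarrow> 'a::euclidean_space set \<Rightarrow> ('a \<Rightarrow> real) \<Rightarrow> bool" where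
  "lipschitz_second_deriv_on L S h \<longleftrightarrow>
     0 \<le> L \<and> (\<forall>z\<in>S. \<forall>w\<in>S. onorm (\<lambda>d. second_deriv h z d - second_deriv h w d) \<le> L * dist z w)"

text \<open>Lipschitz continuity of a matrix-valued map in the spectral norm (the norm of the type
  \<open>real^'b^'a\<close> itself is the Frobenius norm).\<close>

definition lipschitz_matrix_on :: "real \<Rightarrow> 'z::metric_space set \<Rightarrow> ('z \<Rightarrow> real^'b^'a) \<Rightarrow> bool" where
  "lipschitz_matrix_on L S A \<longleftrightarrow>
     0 \<le> L \<and> (\<forall>z\<in>S. \<forall>w\<in>S. onorm (\<lambda>v. (A z - A w) *v v) \<le> L * dist z w)"

definition strongly_convex :: "real \<Rightarrow> ('a::real_normed_vector \<Rightarrow> real) \<Rightarrow> bool" where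
  "strongly_convex \<mu> h \<longleftrightarrow>
     (\<forall>u v t. 0 \<le> t \<and> t \<le> 1 \<longrightarrow>
        h (t *\<^sub>R u + (1 - t) *\<^sub>R v)
          \<le> t * h u + (1 - t) * h v - \<mu> / 2 * t * (1 - t) * (norm (u - v))\<^sup>2)"

definition y_star :: "(real^'n1 \<Rightarrow> real^'n2 \<Rightarrow> real) \<Rightarrow> real^'n1 \<Rightarrow> real^'n2" where
  "y_star f x = (ARG_MIN (f x) y. True)"

definition bilevel_obj ::
  "(real^'n1) set \<Rightarrow> (real^'n1 \<Rightarrow> real^'n2 \<Rightarrow> real) \<Rightarrow> ('m \<Rightarrow> real^'n1 \<Rightarrow> real^'n2 \<Rightarrow> real) \<Rightarrow>
   ('m \<Rightarrow> real^'n1 \<Rightarrow> real) \<Rightarrow> 'm \<Rightarrow> real^'n1 \<Rightarrow> ereal" where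
  "bilevel_obj X f F g i x = (if x \<in> X then ereal (F i x (y_star f x) + g i x) else \<infinity>)"

definition dir_deriv :: "('a::real_vector \<Rightarrow> ereal) \<Rightarrow> 'a \<Rightarrow> 'a \<Rightarrow> ereal" where
  "dir_deriv h x d = Lim (at_right 0) (\<lambda>t::real. (h (x + t *\<^sub>R d) - h x) / ereal t)"

definition pareto_stationary ::
  "(real^'n1) set \<Rightarrow> (real^'n1 \<Rightarrow> real^'n2 \<Rightarrow> real) \<Rightarrow> ('m::finite \<Rightarrow> real^'n1 \<Rightarrow> real^'n2 \<Rightarrow> real) \<Rightarrow>
   ('m \<Rightarrow> real^'n1 \<Rightarrow> real) \<Rightarrow> real^'n1 \<Rightarrow> bool" where
  "pareto_stationary X f F g p \<longleftrightarrow>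
     p \<in> X \<and> (\<forall>d. Max (range (\<lambda>i. dir_deriv (bilevel_obj X f F g i) p d)) \<ge> 0)"

definition d_v ::
  "(real^'n1 \<Rightarrow> real^'n2 \<Rightarrow> real) \<Rightarrow> (real^'n1 \<Rightarrow> real^'n2 \<Rightarrow> real) \<Rightarrow>
   real^'n1 \<Rightarrow> real^'n2 \<Rightarrow> real^'n2 \<Rightarrow> real^'n2" where
  "d_v f Fi x y v = hess_yy f x y *v v - grad_y Fi x y"

definition d_phi ::
  "(real^'n1 \<Rightarrow> real^'n2 \<Rightarrow> real) \<Rightarrow> (real^'n1 \<Rightarrow> real^'n2 \<Rightarrow> real) \<Rightarrow>
   real^'n1 \<Rightarrow> real^'n2 \<Rightarrow> real^'n2 \<Rightarrow> real^'n1" where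
  "d_phi f Fi x y v = grad_x Fi x y - hess_xy f x y *v v"

definition gMOBA ::
  "(real^'n1) set \<Rightarrow> (real^'n1 \<Rightarrow> real^'n2 \<Rightarrow> real) \<Rightarrow> ('m::finite \<Rightarrow> real^'n1 \<Rightarrow> real^'n2 \<Rightarrow> real) \<Rightarrow>
   ('m \<Rightarrow> real^'n1 \<Rightarrow> real) \<Rightarrow> (nat \<Rightarrow> real) \<Rightarrow> real \<Rightarrow> (nat \<Rightarrow> real) \<Rightarrow>
   (nat \<Rightarrow> real^'n1) \<Rightarrow> (nat \<Rightarrow> real^'n2) \<Rightarrow> (nat \<Rightarrow> 'm \<Rightarrow> real^'n2) \<Rightarrow> bool" where
  "gMOBA X f F g \<alpha> \<beta> \<eta> x y v \<longleftrightarrow>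
     x 0 \<in> X \<and>
     (\<forall>k. y (Suc k) = y k - \<beta> *\<^sub>R grad_y f (x k) (y k)) \<and>
     (\<forall>k i. v (Suc k) i = v k i - \<eta> k *\<^sub>R d_v f (F i) (x k) (y k) (v k i)) \<and>
     (\<forall>k. is_arg_min
        (\<lambda>u. Max (range (\<lambda>i. d_phi f (F i) (x k) (y k) (v k i) \<bullet> (u - x k) + g i u - g i (x k)))
             + 1 / (2 * \<alpha> k) * (norm (u - x k))\<^sup>2)
        (\<lambda>u. u \<in> X) (x (Suc k)))"

text \<open>\<open>L_v / \<mu>\<^sup>3\<close> is the Lipschitz constant on \<open>X\<close> that the data give for the exact solution
  \<open>x \<mapsto> (\<nabla>\<^sub>y\<^sub>y f)\<^sup>-\<^sup>1 \<nabla>\<^sub>y F\<^sub>i\<close>, evaluated at \<open>(x, y_star f x)\<close>, of the linear system solved by \<open>v\<close>.\<close>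

definition L_v :: "real \<Rightarrow> real \<Rightarrow> real \<Rightarrow> real \<Rightarrow> real \<Rightarrow> real" where
  "L_v \<mu> C_Fy L_Fy L_fy L_fyy =
     C_Fy * L_fyy * L_fy + \<mu> * (C_Fy * L_fyy + L_Fy * L_fy) + \<mu>\<^sup>2 * L_Fy"

end

theory Submission
  imports Defs
begin

text \<open>
  Write \<open>G\<close> for the gradient of \<open>f\<close> in \<open>y\<close>, with partial derivatives \<open>H\<close> in \<open>y\<close> and \<open>J\<close> in \<open>x\<close>, and
  let \<open>v\<^sub>i(x)\<close> solve \<open>H v = \<nabla>\<^sub>y F\<^sub>i\<close> at \<open>(x, y_star f x)\<close>. The second derivative \<open>H\<close> is symmetric, with
  spectrum in \<open>[\<mu>, L_fy]\<close> by strong convexity; hence \<open>y_star f\<close> and \<open>v\<^sub>i\<close> are Lipschitz continuous on \<open>X\<close>, with constants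
  \<open>L_fy / \<mu>\<close> and \<open>L_v / \<mu>\<^sup>3\<close>. The function \<open>\<phi>\<^sub>i(x) = F\<^sub>i(x, y_star f x)\<close> agrees on the graph of
  \<open>y_star f\<close> with a Lagrangian whose derivative in \<open>y\<close> vanishes there, so it is differentiable within
  \<open>X\<close> with the hypergradient as its derivative (\<open>phi_has_derivative\<close>). No implicit function
  theorem is used, as strong convexity is available for \<open>x\<close> in \<open>X\<close> only, and \<open>X\<close> may have empty interior.

  The \<open>y\<close>- and \<open>v\<close>-steps contract towards \<open>y_star f x\<close> and \<open>v\<^sub>i(x)\<close> with factors \<open>1 - \<beta> \<mu>\<close> and
  \<open>1 - \<eta> \<mu>\<close>, the latter up to a multiple of \<open>\<eta>\<close> times the error in \<open>y\<close>. Let \<open>s\<close> be the length of the step in \<open>x\<close>, \<open>\<delta>\<close> the error in \<open>y\<close> and \<open>\<epsilon>\<close> the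
  error in \<open>v\<^sub>i\<close>. Comparing the new point with the current one in the proximal subproblem makes the
  model of every objective drop by at least \<open>s\<^sup>2 / (2 \<alpha>)\<close>. The bounds on \<open>\<alpha>\<close> are what is needed for
  \<open>\<Phi>\<^sub>i + weight * \<delta>\<^sup>2 + \<epsilon>\<^sup>2\<close> to decrease, for each \<open>i\<close> separately, by at least
  \<open>s\<^sup>2 + \<delta>\<^sup>2 + (\<eta> \<mu> / 2) \<epsilon>\<^sup>2\<close> (\<open>lyap_decrease\<close>). Along the subsequence converging to \<open>p\<close> this
  function is bounded below; as it is monotone, it is bounded below along the whole sequence, and so
  \<open>s\<close>, \<open>\<delta>\<close> and \<open>\<epsilon>\<close> tend to \<open>0\<close> (\<open>errors_tendsto_0\<close>).

  The optimality of the proximal step therefore passes to the limit: \<open>p\<close> minimises over \<open>X\<close> the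
  maximum of the exact models plus the proximal term (\<open>proximal_optimality_limit\<close>). Testing this with
  \<open>p + t d\<close> and letting \<open>t\<close> tend to \<open>0\<close> gives Pareto stationarity (\<open>pareto_stationaryI_proximal\<close>).
\<close>

section \<open>Derivatives along rays\<close>

lemma has_derivative_ray_limit:
  assumes "(f has_derivative D) (at x within S)"
    and "eventually (\<lambda>t::real. x + t *\<^sub>R d \<in> S) (at_right 0)"
  shows "((\<lambda>t. (f (x + t *\<^sub>R d) - f x) /\<^sub>R t) \<longlongrightarrow> D d) (at_right 0)"
proof -
  interpret D: bounded_linear D using assms(1) by (rule has_derivative_bounded_linear)
  define T where "T = {t::real. 0 < t \<and> x + t *\<^sub>R d \<in> S}"
  have le: "at_right (0::real) \<le> at 0 within T"
  proof -
    have "eventually (\<lambda>t. t \<in> T) (at_right 0)"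
      using assms(2) eventually_at_right_less[of 0] by eventually_elim (auto simp: T_def)
    then show ?thesis
      by (auto simp: at_within_def le_inf_iff le_principal T_def eventually_inf_principal
          intro: filter_leI elim: eventually_mono)
  qed
  have line: "((\<lambda>t::real. x + t *\<^sub>R d) has_derivative (\<lambda>t. t *\<^sub>R d)) (at 0 within T)"
    by (auto intro!: derivative_eq_intros)
  have "((\<lambda>t. f (x + t *\<^sub>R d)) has_derivative (\<lambda>t. D (t *\<^sub>R d))) (at 0 within T)"
    by (rule has_derivative_in_compose[OF line])
       (auto intro!: has_derivative_subset[OF assms(1)] simp: T_def)
  then have "((\<lambda>t. f (x + t *\<^sub>R d)) has_vector_derivative D d) (at 0 within T)"
    by (simp add: has_vector_derivative_def D.scaleR)
  then have "((\<lambda>t. (f (x + t *\<^sub>R d) - f x) /\<^sub>R t) \<longlongrightarrow> D d) (at 0 within T)"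
  proof -
    assume "((\<lambda>t. f (x + t *\<^sub>R d)) has_vector_derivative D d) (at 0 within T)"
    then have "((\<lambda>t. (f (x + t *\<^sub>R d) - (f x + t *\<^sub>R D d)) /\<^sub>R \<bar>t\<bar>) \<longlongrightarrow> 0) (at 0 within T)"
      by (simp add: has_vector_derivative_def has_derivative_within divide_inverse)
    moreover have "eventually (\<lambda>t. (f (x + t *\<^sub>R d) - (f x + t *\<^sub>R D d)) /\<^sub>R \<bar>t\<bar>
        = (f (x + t *\<^sub>R d) - f x) /\<^sub>R t - D d) (at 0 within T)"
      by (auto simp: eventually_at_filter T_def algebra_simps)
    ultimately show ?thesis
      by (subst LIM_zero_iff[symmetric]) (auto elim: Lim_transform_eventually)
  qed
  then show ?thesis using le by (rule tendsto_mono[rotated])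
qed

lemma convex_eventually_ray_in:
  fixes X :: "'a::real_vector set"
  assumes "convex X" "x \<in> X" "x + \<tau> *\<^sub>R d \<in> X" "0 < \<tau>"
  shows "eventually (\<lambda>t. x + t *\<^sub>R d \<in> X) (at_right 0)"
proof (rule eventually_at_rightI[OF _ assms(4)])
  fix t assume t: "t \<in> {0<..<\<tau>}"
  have "(1 - t / \<tau>) *\<^sub>R x + (t / \<tau>) *\<^sub>R (x + \<tau> *\<^sub>R d) \<in> X"
    using t assms by (intro convexD[OF assms(1)]) auto
  moreover have "(1 - t / \<tau>) *\<^sub>R x + (t / \<tau>) *\<^sub>R (x + \<tau> *\<^sub>R d) = x + t *\<^sub>R d"
    using t assms(4) by (simp add: algebra_simps)
  ultimately show "x + t *\<^sub>R d \<in> X" by simp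
qed

lemma norm_derivative_ray_le:
  assumes "(f has_derivative D) (at x)"
    and "eventually (\<lambda>t::real. norm (f (x + t *\<^sub>R d) - f x) \<le> L * norm (t *\<^sub>R d)) (at_right 0)"
  shows "norm (D d) \<le> L * norm d"
proof (rule tendsto_upperbound)
  show "((\<lambda>t. norm ((f (x + t *\<^sub>R d) - f x) /\<^sub>R t)) \<longlongrightarrow> norm (D d)) (at_right 0)"
    by (intro tendsto_norm has_derivative_ray_limit[where S=UNIV]) (use assms in auto)
  show "\<forall>\<^sub>F t in at_right 0. norm ((f (x + t *\<^sub>R d) - f x) /\<^sub>R t) \<le> L * norm d"
    using assms(2) eventually_at_right_less[of 0]
    by eventually_elim (simp add: divide_inverse_commute[symmetric] divide_le_eq mult_ac)
qed auto

text \<open>Symmetry of the second derivative \<open>D\<close> of \<open>h\<close> at \<open>y\<close>, assuming only that the gradient \<open>G\<close>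
  is differentiable at this one point: both \<open>D w \<bullet> u\<close> and \<open>D u \<bullet> w\<close> are the limit of the second
  difference \<open>S u w t / t\<^sup>2\<close>, which is symmetric in \<open>u\<close> and \<open>w\<close>.\<close>
lemma derivative_symmetric_of_gradient:
  fixes h :: "'a::real_inner \<Rightarrow> real"
  assumes h: "\<And>z. (h has_derivative (\<lambda>d. G z \<bullet> d)) (at z)"
    and G: "(G has_derivative D) (at y)"
  shows "D u \<bullet> w = u \<bullet> D w"
proof -
  interpret D: bounded_linear D using G by (rule has_derivative_bounded_linear)
  define S where "S u w t = h (y + t *\<^sub>R u + t *\<^sub>R w) - h (y + t *\<^sub>R u) - h (y + t *\<^sub>R w) + h y"
    for u w and t :: real
  have lim: "((\<lambda>t. S u w t / t\<^sup>2) \<longlongrightarrow> D w \<bullet> u) (at_right 0)" for u w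
  proof (rule tendstoI)
    fix e :: real assume e: "e > 0"
    define N where "N = norm u + norm w"
    define K where "K = N * norm u + 1"
    define e' where "e' = e / (2 * K)"
    have N0: "N \<ge> 0" "N * norm u \<ge> 0" by (auto simp: N_def)
    then have K0: "K > 0" by (simp add: K_def add_nonneg_pos)
    have e': "e' > 0" using e K0 by (simp add: e'_def)
    have ee: "2 * e' * N * norm u < e"
    proof -
      have "2 * e' * N * norm u = e * ((N * norm u) / K)"
        by (simp add: e'_def)
      also have "\<dots> < e * 1"
        using e K0 by (intro mult_strict_left_mono) (auto simp: K_def)
      finally show ?thesis by simp
    qed
    obtain r where r: "r > 0"
      and Gr: "\<And>d. norm d < r \<Longrightarrow> norm (G (y + d) - G y - D d) \<le> e' * norm d"
      using G[unfolded has_derivative_at_alt] e'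
      by (metis add_diff_cancel_left')
    have "eventually (\<lambda>t::real. 0 < t \<and> t * (N + 1) < r) (at_right 0)"
      using r N0 by (intro eventually_at_rightI[of 0 "r / (N + 1)"]) (auto simp: field_simps)
    then show "eventually (\<lambda>t. dist (S u w t / t\<^sup>2) (D w \<bullet> u) < e) (at_right 0)"
    proof eventually_elim
      case (elim t)
      then have t: "t > 0" "t * N < r" by (auto simp: algebra_simps)
      define k where "k s = h (y + s *\<^sub>R u + t *\<^sub>R w) - h (y + s *\<^sub>R u)" for s
      define k' where "k' s = (G (y + s *\<^sub>R u + t *\<^sub>R w) - G (y + s *\<^sub>R u)) \<bullet> u" for s
      have k: "(k has_derivative (\<lambda>d. d * k' s)) (at s within {0..t})" for s
        unfolding k_def k'_def
        by (rule derivative_eq_intros has_derivative_compose[OF _ h] refl)+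
           (auto simp: fun_eq_iff algebra_simps inner_diff_left)
      \<comment> \<open>\<open>S u w t = k t - k 0\<close>, so the mean value theorem turns it into a first difference of \<open>G\<close>.\<close>
      obtain s where s: "0 < s" "s < t" and ks: "k t - k 0 = t * k' s"
        using mvt_simple[of 0 t k "\<lambda>s d. d * k' s"] t(1) k by auto
      have su: "norm (s *\<^sub>R u) \<le> t * N" "norm (s *\<^sub>R u + t *\<^sub>R w) \<le> t * N"
      proof -
        have "s * norm u \<le> t * norm u" using s by (intro mult_right_mono) auto
        moreover have "0 \<le> t * norm w" using t(1) by (intro mult_nonneg_nonneg) auto
        ultimately show "norm (s *\<^sub>R u) \<le> t * N"
          using s(1) unfolding N_def distrib_left norm_scaleR by linarith
        have "norm (s *\<^sub>R u + t *\<^sub>R w) \<le> s * norm u + t * norm w"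
          using norm_triangle_ineq[of "s *\<^sub>R u" "t *\<^sub>R w"] s t by simp
        then show "norm (s *\<^sub>R u + t *\<^sub>R w) \<le> t * N"
          using \<open>s * norm u \<le> t * norm u\<close> unfolding N_def distrib_left by linarith
      qed
      define r1 where "r1 = G (y + (s *\<^sub>R u + t *\<^sub>R w)) - G y - D (s *\<^sub>R u + t *\<^sub>R w)"
      define r2 where "r2 = G (y + s *\<^sub>R u) - G y - D (s *\<^sub>R u)"
      have "norm r1 \<le> e' * (t * N)" "norm r2 \<le> e' * (t * N)"
        unfolding r1_def r2_def
        using su t e' by (auto intro!: order_trans[OF Gr] mult_left_mono)
      then have r12: "norm (r1 - r2) \<le> 2 * e' * (t * N)"
        using norm_triangle_ineq4[of r1 r2] by linarith
      have "k' s = (t *\<^sub>R D w + (r1 - r2)) \<bullet> u"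
        by (simp add: k'_def r1_def r2_def D.add D.scaleR add.assoc)
      then have "k' s = t * (D w \<bullet> u) + (r1 - r2) \<bullet> u"
        by (simp only: inner_add_left inner_scaleR_left)
      moreover have "S u w t = t * k' s"
        using ks by (simp add: S_def k_def)
      ultimately have "S u w t / t\<^sup>2 - D w \<bullet> u = ((r1 - r2) \<bullet> u) / t"
        using t(1) by (simp add: power2_eq_square add_divide_distrib distrib_left)
      also have "\<bar>\<dots>\<bar> \<le> 2 * e' * N * norm u"
      proof -
        have "\<bar>(r1 - r2) \<bullet> u\<bar> \<le> norm (r1 - r2) * norm u" by (rule Cauchy_Schwarz_ineq2)
        also have "\<dots> \<le> 2 * e' * (t * N) * norm u" using r12 by (intro mult_right_mono) auto
        finally show ?thesis using t(1) by (simp add: field_simps)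
      qed
      finally show ?case using ee by (simp add: dist_real_def)
    qed
  qed
  have "S u w = S w u" by (auto simp: S_def fun_eq_iff algebra_simps)
  with lim[of u w] lim[of w u] have "D w \<bullet> u = D u \<bullet> w"
    by (auto intro: tendsto_unique[rotated])
  then show ?thesis by (simp add: inner_commute)
qed

section \<open>Strongly convex functions\<close>

lemma strongly_convex_ge_tangent:
  fixes h :: "'a::real_inner \<Rightarrow> real"
  assumes sc: "strongly_convex \<mu> h" and h: "(h has_derivative (\<lambda>d. g \<bullet> d)) (at z)"
  shows "h z + g \<bullet> (u - z) + \<mu> / 2 * (norm (u - z))\<^sup>2 \<le> h u"
proof -
  have "g \<bullet> (u - z) \<le> h u - h z - \<mu> / 2 * (1 - 0) * (norm (u - z))\<^sup>2"
  proof (rule tendsto_le)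
    show "((\<lambda>t. (h (z + t *\<^sub>R (u - z)) - h z) /\<^sub>R t) \<longlongrightarrow> g \<bullet> (u - z)) (at_right 0)"
      by (rule has_derivative_ray_limit[where S=UNIV]) (use h in auto)
    show "((\<lambda>t::real. h u - h z - \<mu> / 2 * (1 - t) * (norm (u - z))\<^sup>2) \<longlongrightarrow>
        h u - h z - \<mu> / 2 * (1 - 0) * (norm (u - z))\<^sup>2) (at_right 0)"
      by (intro tendsto_intros)
    have "eventually (\<lambda>t::real. 0 < t \<and> t < 1) (at_right 0)"
      by (intro eventually_at_rightI[of 0 1]) auto
    then show "\<forall>\<^sub>F t in at_right 0. (h (z + t *\<^sub>R (u - z)) - h z) /\<^sub>R t
        \<le> h u - h z - \<mu> / 2 * (1 - t) * (norm (u - z))\<^sup>2"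
    proof eventually_elim
      case (elim t)
      have "h (t *\<^sub>R u + (1 - t) *\<^sub>R z)
          \<le> t * h u + (1 - t) * h z - \<mu> / 2 * t * (1 - t) * (norm (u - z))\<^sup>2"
        using sc elim by (simp add: strongly_convex_def)
      moreover have "t *\<^sub>R u + (1 - t) *\<^sub>R z = z + t *\<^sub>R (u - z)" by (simp add: algebra_simps)
      ultimately have "h (z + t *\<^sub>R (u - z)) - h z
          \<le> t * (h u - h z - \<mu> / 2 * (1 - t) * (norm (u - z))\<^sup>2)"
        by (simp add: algebra_simps)
      then show ?case using elim by (simp add: field_simps)
    qed
  qed auto
  then show ?thesis by simp
qed

lemma strongly_convex_gradient_mono:
  fixes h :: "'a::real_inner \<Rightarrow> real"
  assumes "strongly_convex \<mu> h" and "\<And>z. (h has_derivative (\<lambda>d. G z \<bullet> d)) (at z)"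
  shows "\<mu> * (norm (u - z))\<^sup>2 \<le> (G u - G z) \<bullet> (u - z)"
  using strongly_convex_ge_tangent[OF assms(1,2), of u z] 
    strongly_convex_ge_tangent[OF assms(1,2), of z u]
  by (simp add: norm_minus_commute[of z u] inner_diff_left inner_diff_right)

lemma derivative_ge_of_strongly_monotone:
  fixes G :: "'a::real_inner \<Rightarrow> 'a"
  assumes G: "(G has_derivative D) (at y)"
    and mono: "\<And>u z. \<mu> * (norm (u - z))\<^sup>2 \<le> (G u - G z) \<bullet> (u - z)"
  shows "\<mu> * (norm w)\<^sup>2 \<le> D w \<bullet> w"
proof (rule tendsto_lowerbound)
  show "((\<lambda>t. ((G (y + t *\<^sub>R w) - G y) /\<^sub>R t) \<bullet> w) \<longlongrightarrow> D w \<bullet> w) (at_right 0)"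
    by (intro tendsto_intros has_derivative_ray_limit[where S=UNIV]) (use G in auto)
  show "\<forall>\<^sub>F t in at_right 0. \<mu> * (norm w)\<^sup>2 \<le> ((G (y + t *\<^sub>R w) - G y) /\<^sub>R t) \<bullet> w"
    using eventually_at_right_less[of 0]
  proof eventually_elim
    case (elim t)
    have "\<mu> * (norm (t *\<^sub>R w))\<^sup>2 \<le> (G (y + t *\<^sub>R w) - G y) \<bullet> (t *\<^sub>R w)"
      using mono[of "y + t *\<^sub>R w" y] by simp
    then have "t * (t * (\<mu> * (norm w)\<^sup>2)) \<le> t * ((G (y + t *\<^sub>R w) - G y) \<bullet> w)"
      by (simp add: power_mult_distrib power2_eq_square mult_ac)
    then have "t * (\<mu> * (norm w)\<^sup>2) \<le> (G (y + t *\<^sub>R w) - G y) \<bullet> w"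
      using elim mult_le_cancel_left_pos by blast
    then show ?case using elim
      by (simp add: divide_inverse_commute[symmetric] le_divide_eq mult_ac)
  qed
qed auto

lemma strongly_convex_has_minimum:
  fixes h :: "'a::euclidean_space \<Rightarrow> real"
  assumes sc: "strongly_convex \<mu> h" and \<mu>: "\<mu> > 0"
    and h: "\<And>z. (h has_derivative (\<lambda>d. G z \<bullet> d)) (at z)"
  shows "\<exists>z. is_arg_min h (\<lambda>_. True) z"
proof -
  \<comment> \<open>Outside the ball of radius \<open>R\<close> the quadratic term of the tangent bound at \<open>0\<close> outweighs the
    linear one.\<close>
  define R where "R = 2 * norm (G 0) / \<mu>"
  have R: "R \<ge> 0" using \<mu> by (simp add: R_def)
  have "continuous_on (cball 0 R) h"
    using h by (auto intro!: continuous_at_imp_continuous_on has_derivative_continuous)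
  then obtain z where z: "\<And>u. u \<in> cball 0 R \<Longrightarrow> h z \<le> h u"
    using continuous_attains_inf[of "cball 0 R" h] R by force
  have "h z \<le> h u" for u
  proof (cases "norm u \<le> R")
    case False
    have "h 0 \<le> h u - G 0 \<bullet> u - \<mu> / 2 * (norm u)\<^sup>2"
      using strongly_convex_ge_tangent[OF sc h, of 0 u] by simp
    also have "\<dots> \<le> h u + norm (G 0) * norm u - \<mu> / 2 * (norm u)\<^sup>2"
      using Cauchy_Schwarz_ineq2[of "G 0" u] by linarith
    also have "\<dots> = h u - norm u * (\<mu> / 2 * (norm u - R))"
      using \<mu> by (simp add: R_def power2_eq_square field_simps)
    also have "\<dots> \<le> h u" using False \<mu> by simp
    finally show ?thesis using z[of 0] R by simp
  qed (use z in simp)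
  then have "is_arg_min h (\<lambda>_. True) z" by (auto simp: is_arg_min_def not_less)
  then show ?thesis ..
qed

lemma gradient_arg_min_eq_0:
  fixes h :: "'a::euclidean_space \<Rightarrow> real"
  assumes "strongly_convex \<mu> h" and "\<mu> > 0"
    and h: "\<And>z. (h has_derivative (\<lambda>d. G z \<bullet> d)) (at z)"
  shows "G (arg_min h (\<lambda>_. True)) = 0"
proof -
  let ?z = "arg_min h (\<lambda>_. True)"
  have "is_arg_min h (\<lambda>_. True) ?z"
    unfolding arg_min_def using strongly_convex_has_minimum[OF assms] by (rule someI_ex)
  then have "\<And>u. h ?z \<le> h u" by (auto simp: is_arg_min_def not_less)
  then have "(\<lambda>d. G ?z \<bullet> d) = (\<lambda>d. 0)"
    using differential_zero_maxmin[OF _ open_UNIV h[of ?z]] by auto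
  then show ?thesis by (metis inner_eq_zero_iff)
qed

section \<open>Symmetric operators\<close>

text \<open>By polarisation, a bound on the quadratic form of a symmetric operator bounds its norm.\<close>
lemma norm_le_of_symmetric_quadratic_form:
  fixes A :: "'a::real_inner \<Rightarrow> 'a"
  assumes A: "linear A" and sym: "\<And>u w. A u \<bullet> w = u \<bullet> A w"
    and q: "\<And>w. \<bar>A w \<bullet> w\<bar> \<le> q * (norm w)\<^sup>2"
  shows "norm (A w) \<le> q * norm w"
proof -
  interpret linear A by fact
  have key: "A u \<bullet> w \<le> q / 2 * ((norm u)\<^sup>2 + (norm w)\<^sup>2)" for u w
  proof -
    have "4 * (A u \<bullet> w) = A (u + w) \<bullet> (u + w) - A (u - w) \<bullet> (u - w)"
      using sym[of w u] by (simp add: add diff inner_simps inner_commute)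
    also have "\<dots> \<le> q * (norm (u + w))\<^sup>2 + q * (norm (u - w))\<^sup>2"
      using q[of "u + w"] q[of "u - w"] by linarith
    also have "\<dots> = 2 * q * ((norm u)\<^sup>2 + (norm w)\<^sup>2)"
      by (simp add: power2_norm_eq_inner inner_simps inner_commute algebra_simps)
    finally show ?thesis by simp
  qed
  show ?thesis
  proof (cases "w = 0 \<or> A w = 0")
    case True
    moreover have "0 \<le> q" if "w \<noteq> 0"
      using q[of w] that
      by (smt (verit) zero_le_mult_iff zero_less_norm_iff zero_less_power2)
    ultimately show ?thesis using zero by (cases "w = 0") auto
  next
    case False
    \<comment> \<open>\<open>key\<close> is sharp when its second vector has the length of \<open>w\<close> and the direction of \<open>A w\<close>.\<close>
    define c where "c = norm w / norm (A w)"
    have "A w \<bullet> (c *\<^sub>R A w) \<le> q / 2 * ((norm w)\<^sup>2 + (norm (c *\<^sub>R A w))\<^sup>2)" by (rule key)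
    moreover have "A w \<bullet> (c *\<^sub>R A w) = norm w * norm (A w)"
      using False by (simp add: c_def power2_norm_eq_inner[symmetric] power2_eq_square)
    moreover have "norm (c *\<^sub>R A w) = norm w" using False by (simp add: c_def)
    ultimately have "norm w * norm (A w) \<le> q / 2 * ((norm w)\<^sup>2 + (norm w)\<^sup>2)"
      by (simp only:)
    then have "norm w * norm (A w) \<le> norm w * (q * norm w)"
      by (simp add: power2_eq_square mult_ac)
    then show ?thesis using False by (simp add: mult_le_cancel_left)
  qed
qed

text \<open>For \<open>\<eta> \<le> 2 / (\<mu> + L)\<close> the spectrum of \<open>1 - \<eta> H\<close> lies in \<open>[1 - \<eta> L, 1 - \<eta> \<mu>]\<close>, and
  \<open>\<eta> L - 1 \<le> 1 - \<eta> \<mu>\<close>.\<close>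
lemma norm_gradient_step_le:
  fixes H :: "'a::real_inner \<Rightarrow> 'a"
  assumes H: "linear H" and sym: "\<And>u w. H u \<bullet> w = u \<bullet> H w"
    and lo: "\<And>w. \<mu> * (norm w)\<^sup>2 \<le> H w \<bullet> w" and up: "\<And>w. norm (H w) \<le> L * norm w"
    and \<eta>: "0 < \<eta>" "\<eta> \<le> 2 / (\<mu> + L)" "0 < \<mu>" "0 \<le> L"
  shows "norm (w - \<eta> *\<^sub>R H w) \<le> (1 - \<eta> * \<mu>) * norm w"
proof (rule norm_le_of_symmetric_quadratic_form[where A="\<lambda>w. w - \<eta> *\<^sub>R H w"])
  interpret linear H by fact
  show "linear (\<lambda>w. w - \<eta> *\<^sub>R H w)" by (rule linearI) (auto simp: add scale algebra_simps)
  show "(u - \<eta> *\<^sub>R H u) \<bullet> w = u \<bullet> (w - \<eta> *\<^sub>R H w)" for u w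
    by (simp add: inner_simps sym)
  fix w
  have "H w \<bullet> w \<le> norm (H w) * norm w" by (rule norm_cauchy_schwarz)
  also have "\<dots> \<le> L * norm w * norm w" using up by (intro mult_right_mono) auto
  finally have "H w \<bullet> w \<le> L * (norm w)\<^sup>2" by (simp add: power2_eq_square mult_ac)
  then have 1: "\<eta> * (H w \<bullet> w) \<le> \<eta> * L * (norm w)\<^sup>2" using \<eta>
    by (simp add: mult.assoc)
  have 2: "\<eta> * \<mu> * (norm w)\<^sup>2 \<le> \<eta> * (H w \<bullet> w)" using \<eta> lo[of w]
    by (simp add: mult.assoc)
  have "\<eta> * L - 1 \<le> 1 - \<eta> * \<mu>" using \<eta> by (simp add: field_simps)
  then have "(\<eta> * L - 1) * (norm w)\<^sup>2 \<le> (1 - \<eta> * \<mu>) * (norm w)\<^sup>2"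
    by (intro mult_right_mono) auto
  then show "\<bar>(w - \<eta> *\<^sub>R H w) \<bullet> w\<bar> \<le> (1 - \<eta> * \<mu>) * (norm w)\<^sup>2"
    using 1 2 by (simp add: inner_simps power2_norm_eq_inner[symmetric] algebra_simps)
qed

section \<open>One objective of a bilevel problem with strongly convex lower level\<close>

text \<open>\<open>G\<close> is the gradient in \<open>y\<close> of the lower-level function, \<open>H\<close> and \<open>J\<close> are its partial
  derivatives in \<open>y\<close> and in \<open>x\<close>, and \<open>ys\<close> is the lower-level solution, of which only stationarity
  is required. \<open>F\<close> is the smooth part of the objective, with gradient \<open>(P, Q)\<close>. Distances in
  the product space are bounded by the sum of the distances of the components.\<close>
locale bilevel_objective =
  fixes X :: "'a::euclidean_space set"
    and G :: "'a \<Rightarrow> 'b::euclidean_space \<Rightarrow> 'b"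
    and H :: "'a \<Rightarrow> 'b \<Rightarrow> 'b \<Rightarrow> 'b" and J :: "'a \<Rightarrow> 'b \<Rightarrow> 'a \<Rightarrow> 'b"
    and ys :: "'a \<Rightarrow> 'b"
    and F :: "'a \<Rightarrow> 'b \<Rightarrow> real" and P :: "'a \<Rightarrow> 'b \<Rightarrow> 'a" and Q :: "'a \<Rightarrow> 'b \<Rightarrow> 'b"
    and \<mu> L LH LJ LP LQ C :: real
  assumes convex_X: "convex X" and mu_pos: "0 < \<mu>"
    and nonneg: "0 \<le> L" "0 \<le> LH" "0 \<le> LJ" "0 \<le> LP" "0 \<le> LQ" "0 \<le> C"
    and G_deriv: "x \<in> X \<Longrightarrow> ((\<lambda>z. G (fst z) (snd z)) has_derivative
        (\<lambda>d. J x y (fst d) + H x y (snd d))) (at (x, y))"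
    and H_linear: "x \<in> X \<Longrightarrow> linear (H x y)"
    and J_linear: "x \<in> X \<Longrightarrow> linear (J x y)"
    and G_mono: "x \<in> X \<Longrightarrow> \<mu> * (norm (u - z))\<^sup>2 \<le> (G x u - G x z) \<bullet> (u - z)"
    and H_sym: "x \<in> X \<Longrightarrow> H x y u \<bullet> w = u \<bullet> H x y w"
    and G_ys: "x \<in> X \<Longrightarrow> G x (ys x) = 0"
    and F_deriv: "x \<in> X \<Longrightarrow> ((\<lambda>z. F (fst z) (snd z)) has_derivative
        (\<lambda>d. P x y \<bullet> fst d + Q x y \<bullet> snd d)) (at (x, y))"
    and G_lip: "x \<in> X \<Longrightarrow> x' \<in> X \<Longrightarrow>
        norm (G x y - G x' y') \<le> L * (norm (x - x') + norm (y - y'))"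
    and H_lip: "x \<in> X \<Longrightarrow> x' \<in> X \<Longrightarrow>
        norm (H x y w - H x' y' w) \<le> LH * (norm (x - x') + norm (y - y')) * norm w"
    and J_lip: "x \<in> X \<Longrightarrow> x' \<in> X \<Longrightarrow>
        norm (J x y d - J x' y' d) \<le> LJ * (norm (x - x') + norm (y - y')) * norm d"
    and P_lip: "x \<in> X \<Longrightarrow> x' \<in> X \<Longrightarrow>
        norm (P x y - P x' y') \<le> LP * (norm (x - x') + norm (y - y'))"
    and Q_lip: "x \<in> X \<Longrightarrow> x' \<in> X \<Longrightarrow>
        norm (Q x y - Q x' y') \<le> LQ * (norm (x - x') + norm (y - y'))"
    and Q_bound: "x \<in> X \<Longrightarrow> norm (Q x y) \<le> C"
begin


subsection \<open>The partial derivatives of the lower-level gradient\<close>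

lemma G_deriv_y:
  assumes "x \<in> X"
  shows "(G x has_derivative H x y) (at y)"
proof -
  have "((\<lambda>y'. (x, y')) has_derivative (\<lambda>d. (0, d))) (at y)"
    by (auto intro!: derivative_eq_intros)
  from has_derivative_compose[OF this G_deriv[OF assms]] show ?thesis
    using linear_0[OF J_linear[OF assms]] by simp
qed

lemma G_deriv_x:
  assumes "x \<in> X"
  shows "((\<lambda>x'. G x' y) has_derivative J x y) (at x)"
proof -
  have "((\<lambda>x'. (x', y)) has_derivative (\<lambda>d. (d, 0))) (at x)"
    by (auto intro!: derivative_eq_intros)
  from has_derivative_compose[OF this G_deriv[OF assms]] show ?thesis
    using linear_0[OF H_linear[OF assms]] by simp
qed

lemma H_ge: "x \<in> X \<Longrightarrow> \<mu> * (norm w)\<^sup>2 \<le> H x y w \<bullet> w"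
  by (rule derivative_ge_of_strongly_monotone[OF G_deriv_y G_mono])

lemma norm_H_ge:
  assumes "x \<in> X"
  shows "\<mu> * norm w \<le> norm (H x y w)"
proof (cases "w = 0")
  case False
  have "norm w * (\<mu> * norm w) \<le> norm w * norm (H x y w)"
    using H_ge[OF assms, of w y] norm_cauchy_schwarz[of "H x y w" w]
    by (simp add: power2_eq_square mult_ac)
  then show ?thesis using False by (simp add: mult_le_cancel_left)
qed simp

lemma norm_H_le:
  assumes "x \<in> X"
  shows "norm (H x y w) \<le> L * norm w"
proof (rule norm_derivative_ray_le[OF G_deriv_y[OF assms]])
  show "\<forall>\<^sub>F t in at_right 0. norm (G x (y + t *\<^sub>R w) - G x y) \<le> L * norm (t *\<^sub>R w)"
    using G_lip[OF assms assms, of "y + _ *\<^sub>R w" y] by simp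
qed

text \<open>\<open>G\<close> is Lipschitz continuous on \<open>X\<close> only, so the bound \<open>L\<close> on its derivative in \<open>x\<close> holds
  in the directions that stay in \<open>X\<close>.\<close>
lemma norm_J_le:
  assumes "x \<in> X" and d: "eventually (\<lambda>t. x + t *\<^sub>R d \<in> X) (at_right 0)"
  shows "norm (J x y d) \<le> L * norm d"
proof (rule norm_derivative_ray_le[OF G_deriv_x[OF assms(1)]])
  show "\<forall>\<^sub>F t in at_right 0. norm (G (x + t *\<^sub>R d) y - G x y) \<le> L * norm (t *\<^sub>R d)"
    using d
  proof eventually_elim
    case (elim t)
    then show ?case using G_lip[OF elim assms(1), of y y] by simp
  qed
qed

lemma mu_le_L:
  assumes "x \<in> X"
  shows "\<mu> \<le> L"
proof -
  obtain w :: 'b where w: "norm w = 1" using vector_choose_size zero_le_one by blast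
  then show ?thesis using norm_H_ge[OF assms, of w undefined] norm_H_le[OF assms, of undefined w]
    by simp
qed

subsection \<open>The lower-level solution and the solution of the adjoint equation\<close>

lemma ys_lip:
  assumes "x \<in> X" "x' \<in> X"
  shows "norm (ys x - ys x') \<le> L / \<mu> * norm (x - x')"
proof (cases "ys x = ys x'")
  case False
  have "\<mu> * (norm (ys x - ys x'))\<^sup>2 \<le> (G x (ys x) - G x (ys x')) \<bullet> (ys x - ys x')"
    by (rule G_mono[OF assms(1)])
  also have "\<dots> = (G x' (ys x') - G x (ys x')) \<bullet> (ys x - ys x')"
    using G_ys assms by simp
  also have "\<dots> \<le> norm (G x' (ys x') - G x (ys x')) * norm (ys x - ys x')"
    by (rule norm_cauchy_schwarz)
  also have "\<dots> \<le> L * norm (x - x') * norm (ys x - ys x')"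
    using G_lip[OF assms(2,1), of "ys x'" "ys x'"]
    by (intro mult_right_mono) (auto simp: norm_minus_commute)
  finally have "norm (ys x - ys x') * (\<mu> * norm (ys x - ys x')) 
      \<le> norm (ys x - ys x') * (L * norm (x - x'))"
    by (simp add: power2_eq_square mult_ac)
  then have "\<mu> * norm (ys x - ys x') \<le> L * norm (x - x')"
    using False by (simp add: mult_le_cancel_left)
  then show ?thesis using mu_pos by (simp add: field_simps)
qed (use nonneg mu_pos in simp)

text \<open>\<open>vs x\<close> is the adjoint vector at \<open>x\<close>, that is, the exact solution of the linear system that
  the \<open>v\<close>-iteration solves.\<close>
definition vs :: "'a \<Rightarrow> 'b" where
  "vs x = (SOME w. H x (ys x) w = Q x (ys x))"

lemma H_vs:
  assumes "x \<in> X"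
  shows "H x (ys x) (vs x) = Q x (ys x)"
proof -
  have "inj (H x (ys x))"
  proof (rule linear_injective_0[THEN iffD2, OF H_linear[OF assms]], intro allI impI)
    fix w assume "H x (ys x) w = 0"
    then show "w = 0" using norm_H_ge[OF assms, of w "ys x"] mu_pos by (simp add: mult_le_0_iff)
  qed
  then have "surj (H x (ys x))"
    by (intro eucl.linear_inj_imp_surj H_linear assms)
  then show ?thesis unfolding vs_def by (intro someI_ex[of "\<lambda>w. H x (ys x) w = _"]) (metis surjD)
qed

lemma norm_vs_le:
  assumes "x \<in> X"
  shows "norm (vs x) \<le> C / \<mu>"
  using norm_H_ge[OF assms, of "vs x" "ys x"] Q_bound[OF assms, of "ys x"] mu_pos
  by (simp add: H_vs[OF assms] field_simps)

text \<open>\<open>K\<close> bounds the error in the adjoint equation at \<open>vs x\<close> per unit of error in \<open>(x, y)\<close>;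
  \<open>LV\<close> is a Lipschitz constant of \<open>vs\<close>.\<close>
definition K :: real where "K = C / \<mu> * LH + LQ"
definition LV :: real where "LV = K * (1 + L / \<mu>) / \<mu>"

lemma K_nonneg: "0 \<le> K" and LV_nonneg: "0 \<le> LV"
  using nonneg mu_pos by (auto simp: K_def LV_def)

lemma adjoint_residual_le:
  assumes "x \<in> X" "x' \<in> X"
  shows "norm (H x' y' (vs x) - Q x' y') \<le> K * (norm (x - x') + norm (ys x - y'))"
proof -
  define D where "D = norm (x - x') + norm (ys x - y')"
  have D: "0 \<le> D" by (simp add: D_def)
  have eq: "H x' y' (vs x) - Q x' y' = (Q x (ys x) - Q x' y') - (H x (ys x) (vs x) - H x' y' (vs x))"
    using H_vs[OF assms(1)] by simp
  have "norm (H x' y' (vs x) - Q x' y')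
      \<le> norm (Q x (ys x) - Q x' y') + norm (H x (ys x) (vs x) - H x' y' (vs x))"
    unfolding eq by (rule norm_triangle_ineq4)
  also have "\<dots> \<le> LQ * D + LH * D * norm (vs x)"
    unfolding D_def by (intro add_mono Q_lip H_lip assms)
  also have "\<dots> \<le> LQ * D + LH * D * (C / \<mu>)"
    using norm_vs_le[OF assms(1)] nonneg D by (intro add_left_mono mult_left_mono) auto
  also have "\<dots> = K * D" by (simp add: K_def algebra_simps)
  finally show ?thesis unfolding D_def .
qed

lemma graph_lip:
  assumes "x \<in> X" "x' \<in> X"
  shows "norm (x - x') + norm (ys x - ys x') \<le> (1 + L / \<mu>) * norm (x - x')"
  using ys_lip[OF assms] by (simp add: algebra_simps)

lemma vs_lip:
  assumes "x \<in> X" "x' \<in> X"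
  shows "norm (vs x - vs x') \<le> LV * norm (x - x')"
proof -
  have "\<mu> * norm (vs x - vs x') \<le> norm (H x' (ys x') (vs x - vs x'))"
    by (rule norm_H_ge[OF assms(2)])
  also have "\<dots> = norm (H x' (ys x') (vs x) - Q x' (ys x'))"
    using H_vs[OF assms(2)] by (simp add: linear_diff[OF H_linear[OF assms(2)]])
  also have "\<dots> \<le> K * (norm (x - x') + norm (ys x - ys x'))"
    by (rule adjoint_residual_le[OF assms])
  also have "\<dots> \<le> K * ((1 + L / \<mu>) * norm (x - x'))"
    by (intro mult_left_mono graph_lip assms K_nonneg)
  finally show ?thesis using mu_pos by (simp add: LV_def field_simps)
qed

subsection \<open>The hypergradient\<close>

text \<open>\<open>phi\<close> is the smooth part of the reduced objective. \<open>E x y w\<close> is the estimate of its derivative,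
  as a linear form, that the method uses at \<open>(x, y, w)\<close>; \<open>dphi x\<close> is the exact derivative of \<open>phi\<close> at \<open>x\<close>.\<close>
definition E :: "'a \<Rightarrow> 'b \<Rightarrow> 'b \<Rightarrow> 'a \<Rightarrow> real" where
  "E x y w d = P x y \<bullet> d - w \<bullet> J x y d"

definition dphi :: "'a \<Rightarrow> 'a \<Rightarrow> real" where "dphi x = E x (ys x) (vs x)"

definition phi :: "'a \<Rightarrow> real" where "phi x = F x (ys x)"

text \<open>The Lagrangian \<open>F x y - vs x0 \<bullet> G x y\<close> agrees with \<open>phi\<close> on the graph of \<open>ys\<close>, and by the
  choice of \<open>vs x0\<close> (and the symmetry of \<open>H\<close>) its partial derivative in \<open>y\<close> vanishes at
  \<open>(x0, ys x0)\<close>. So \<open>ys\<close> need only be Lipschitz continuous.\<close>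
lemma phi_has_derivative:
  assumes x0: "x0 \<in> X"
  shows "(phi has_derivative dphi x0) (at x0 within X)"
proof -
  define \<Psi> where "\<Psi> z = F (fst z) (snd z) - vs x0 \<bullet> G (fst z) (snd z)" for z
  define B where "B = 1 + L / \<mu>"
  have B: "B > 0" using nonneg mu_pos by (auto simp: B_def add_pos_nonneg)
  have "(\<Psi> has_derivative (\<lambda>d. (P x0 (ys x0) \<bullet> fst d + Q x0 (ys x0) \<bullet> snd d)
      - vs x0 \<bullet> (J x0 (ys x0) (fst d) + H x0 (ys x0) (snd d)))) (at (x0, ys x0))"
    unfolding \<Psi>_def
    by (intro has_derivative_diff has_derivative_inner_right F_deriv G_deriv x0)
  also have "(\<lambda>d. (P x0 (ys x0) \<bullet> fst d + Q x0 (ys x0) \<bullet> snd d)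
      - vs x0 \<bullet> (J x0 (ys x0) (fst d) + H x0 (ys x0) (snd d))) = (\<lambda>d. dphi x0 (fst d))"
    using H_sym[OF x0, of "ys x0" "vs x0"] H_vs[OF x0]
    by (auto simp: fun_eq_iff dphi_def E_def inner_add_right)
  finally have \<Psi>: "(\<Psi> has_derivative (\<lambda>d. dphi x0 (fst d))) (at (x0, ys x0))" .
  have \<Psi>_phi: "\<Psi> (x, ys x) = phi x" if "x \<in> X" for x
    using G_ys[OF that] by (simp add: \<Psi>_def phi_def)
  have lin: "linear (dphi x0)"
    unfolding dphi_def E_def
    by (rule linearI) (auto simp: linear_add[OF J_linear[OF x0]] linear_scale[OF J_linear[OF x0]]
        inner_add_right algebra_simps)
  show ?thesis
    unfolding has_derivative_within_alt
  proof (intro conjI allI impI)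
    show "bounded_linear (dphi x0)" using lin by (simp add: linear_conv_bounded_linear)
    fix e :: real assume "e > 0"
    then have "e / B > 0" using B by simp
    then obtain r where r: "r > 0" and \<Psi>r: "\<And>z. norm (z - (x0, ys x0)) < r \<Longrightarrow>
        norm (\<Psi> z - \<Psi> (x0, ys x0) - dphi x0 (fst (z - (x0, ys x0)))) \<le> e / B * norm (z - (x0, ys x0))"
      using \<Psi>[unfolded has_derivative_at_alt] by blast
    show "\<exists>d>0. \<forall>x\<in>X. norm (x - x0) < d \<longrightarrow>
        norm (phi x - phi x0 - dphi x0 (x - x0)) \<le> e * norm (x - x0)"
    proof (intro exI[of _ "r / B"] conjI ballI impI)
      fix x assume x: "x \<in> X" "norm (x - x0) < r / B"
      have le: "norm ((x, ys x) - (x0, ys x0)) \<le> B * norm (x - x0)"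
        using norm_Pair_le[of "x - x0" "ys x - ys x0"] graph_lip[OF x(1) x0]
        by (simp add: B_def)
      also have "\<dots> < r" using x(2) B by (simp add: field_simps)
      finally have "norm (\<Psi> (x, ys x) - \<Psi> (x0, ys x0) - dphi x0 (x - x0))
          \<le> e / B * norm ((x, ys x) - (x0, ys x0))"
        using \<Psi>r[of "(x, ys x)"] by simp
      also have "\<dots> \<le> e / B * (B * norm (x - x0))"
        using le \<open>e / B > 0\<close> by (intro mult_left_mono) auto
      also have "\<dots> = e * norm (x - x0)" using B by simp
      finally show "norm (phi x - phi x0 - dphi x0 (x - x0)) \<le> e * norm (x - x0)"
        using x x0 by (simp add: \<Psi>_phi)
    qed (use r B in simp)
  qed
qed

text \<open>\<open>A\<close> bounds the error of the hypergradient per unit of error in \<open>(x, y)\<close>; \<open>Lphi\<close> is a Lipschitz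
  constant of \<open>dphi\<close>, tested on feasible directions.\<close>
definition A :: real where "A = LP + C / \<mu> * LJ"
definition Lphi :: real where "Lphi = A * (1 + L / \<mu>) + L * LV"

lemma A_nonneg: "0 \<le> A" and Lphi_nonneg: "0 \<le> Lphi"
  using nonneg mu_pos LV_nonneg by (auto simp: A_def Lphi_def)

text \<open>Only \<open>d\<close> feasible at \<open>x'\<close> is admitted, which makes \<open>L\<close> the factor of the error in \<open>w\<close>.\<close>
lemma E_error:
  assumes x: "x \<in> X" and x': "x' \<in> X" and d: "eventually (\<lambda>t. x' + t *\<^sub>R d \<in> X) (at_right 0)"
  shows "\<bar>dphi x d - E x' y w d\<bar>
    \<le> (A * (norm (x - x') + norm (ys x - y)) + L * norm (vs x - w)) * norm d"
proof -
  let ?D = "norm (x - x') + norm (ys x - y)"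
  have eq: "dphi x d - E x' y w d = (P x (ys x) - P x' y) \<bullet> d
      - (vs x \<bullet> (J x (ys x) d - J x' y d) + (vs x - w) \<bullet> J x' y d)"
    by (simp add: dphi_def E_def inner_diff_left inner_diff_right)
  have "\<bar>dphi x d - E x' y w d\<bar> \<le> norm (P x (ys x) - P x' y) * norm d
      + (norm (vs x) * norm (J x (ys x) d - J x' y d) + norm (vs x - w) * norm (J x' y d))"
    unfolding eq using Cauchy_Schwarz_ineq2[of "P x (ys x) - P x' y" d]
      Cauchy_Schwarz_ineq2[of "vs x" "J x (ys x) d - J x' y d"]
      Cauchy_Schwarz_ineq2[of "vs x - w" "J x' y d"] by linarith
  also have "\<dots> \<le> LP * ?D * norm d + (C / \<mu> * (LJ * ?D * norm d) + norm (vs x - w) * (L * norm d))"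
    using nonneg mu_pos
    by (intro add_mono mult_mono P_lip J_lip norm_vs_le norm_J_le x x' d) auto
  finally show ?thesis by (simp add: A_def algebra_simps)
qed

lemma dphi_lip:
  assumes x: "x \<in> X" and x': "x' \<in> X" and d: "eventually (\<lambda>t. x' + t *\<^sub>R d \<in> X) (at_right 0)"
  shows "\<bar>dphi x d - dphi x' d\<bar> \<le> Lphi * norm (x - x') * norm d"
proof -
  have "\<bar>dphi x d - dphi x' d\<bar>
      \<le> (A * (norm (x - x') + norm (ys x - ys x')) + L * norm (vs x - vs x')) * norm d"
    using E_error[OF assms] by (simp add: dphi_def)
  also have "\<dots> \<le> (A * ((1 + L / \<mu>) * norm (x - x')) + L * (LV * norm (x - x'))) * norm d"
    by (intro mult_right_mono add_mono mult_left_mono graph_lip vs_lip x x' A_nonneg nonneg) auto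
  finally show ?thesis by (simp add: Lphi_def algebra_simps)
qed

text \<open>The mean value theorem gives \<open>Lphi\<close> where integration would give half of it. Its
  intermediate point is strictly before \<open>x'\<close>, so that the step direction is feasible there.\<close>
lemma phi_descent:
  assumes x: "x \<in> X" and x': "x' \<in> X"
  shows "phi x' \<le> phi x + dphi x (x' - x) + Lphi * (norm (x' - x))\<^sup>2"
proof -
  define d where "d = x' - x"
  define p where "p t = x + t *\<^sub>R d" for t
  have p: "p t \<in> X" if "t \<in> {0..1}" for t
  proof -
    have "(1 - t) *\<^sub>R x + t *\<^sub>R x' \<in> X" using that x x' by (intro convexD[OF convex_X]) auto
    then show ?thesis by (simp add: p_def d_def algebra_simps)
  qed
  have "((\<lambda>t. phi (p t)) has_derivative (\<lambda>s. dphi (p t) (s *\<^sub>R d))) (at t within {0..1})"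
    if t: "0 \<le> t" "t \<le> 1" for t
  proof -
    have "(p has_derivative (\<lambda>s. s *\<^sub>R d)) (at t within {0..1})"
      unfolding p_def by (auto intro!: derivative_eq_intros)
    moreover have "(phi has_derivative dphi (p t)) (at (p t) within p ` {0..1})"
      using p t by (intro has_derivative_subset[OF phi_has_derivative]) auto
    ultimately show ?thesis by (rule has_derivative_in_compose)
  qed
  from mvt_simple[OF zero_less_one this]
  obtain t where t: "0 < t" "t < 1" and eq: "phi (p 1) - phi (p 0) = dphi (p t) ((1 - 0) *\<^sub>R d)"
    by auto
  have pt: "p t \<in> X" using p t by auto
  have "p t + (1 - t) *\<^sub>R d = x'" by (simp add: p_def d_def algebra_simps)
  then have ev: "eventually (\<lambda>s. p t + s *\<^sub>R d \<in> X) (at_right 0)"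
    using convex_eventually_ray_in[OF convex_X pt, of "1 - t" d] t x' by simp
  have "dphi (p t) d \<le> dphi x d + Lphi * norm (x - p t) * norm d"
    using dphi_lip[OF x pt ev] by simp
  also have "\<dots> \<le> dphi x d + Lphi * norm d * norm d"
    using t Lphi_nonneg by (intro add_left_mono mult_right_mono mult_left_mono) (auto simp: p_def mult_left_le_one_le)
  finally show ?thesis
    using eq by (simp add: p_def d_def power2_eq_square mult.assoc)
qed

subsection \<open>The inner steps\<close>

lemma y_step_contraction:
  assumes x: "x \<in> X" and \<beta>: "0 < \<beta>" "\<beta> \<le> 2 / (\<mu> + L)"
  shows "norm (y - \<beta> *\<^sub>R G x y - ys x) \<le> (1 - \<beta> * \<mu>) * norm (y - ys x)"
proof -
  let ?T = "\<lambda>y. y - \<beta> *\<^sub>R G x y"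
  have "\<beta> * (\<mu> + L) \<le> 2" using \<beta> mu_pos nonneg by (simp add: field_simps)
  moreover have "\<beta> * \<mu> \<le> \<beta> * L" using \<beta> mu_le_L[OF x] by simp
  ultimately have "0 \<le> 1 - \<beta> * \<mu>" by (simp add: algebra_simps)
  have "norm (?T y - ?T (ys x)) \<le> (1 - \<beta> * \<mu>) * norm (y - ys x)"
  proof (rule differentiable_bound[of UNIV])
    show "(?T has_derivative (\<lambda>w. w - \<beta> *\<^sub>R H x u w)) (at u within UNIV)" for u
      by (auto intro!: derivative_eq_intros G_deriv_y x)
    show "onorm (\<lambda>w. w - \<beta> *\<^sub>R H x u w) \<le> 1 - \<beta> * \<mu>" for u
      by (intro onorm_bound \<open>0 \<le> 1 - \<beta> * \<mu>\<close> norm_gradient_step_le[where L=L])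
         (use x \<beta> mu_pos nonneg H_linear H_sym H_ge norm_H_le in auto)
  qed auto
  then show ?thesis using G_ys[OF x] by simp
qed

lemma v_step_contraction:
  assumes x: "x \<in> X" and \<eta>: "0 < \<eta>" "\<eta> \<le> 2 / (\<mu> + L)"
  shows "norm (w - \<eta> *\<^sub>R (H x y w - Q x y) - vs x)
    \<le> (1 - \<eta> * \<mu>) * norm (w - vs x) + \<eta> * (K * norm (y - ys x))"
proof -
  let ?e = "w - vs x"
  let ?r = "H x y (vs x) - Q x y"
  have eq: "w - \<eta> *\<^sub>R (H x y w - Q x y) - vs x = (?e - \<eta> *\<^sub>R H x y ?e) - \<eta> *\<^sub>R ?r"
    by (simp add: linear_diff[OF H_linear[OF x]] algebra_simps)
  have "norm (w - \<eta> *\<^sub>R (H x y w - Q x y) - vs x)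
      \<le> norm (?e - \<eta> *\<^sub>R H x y ?e) + norm (\<eta> *\<^sub>R ?r)"
    unfolding eq by (rule norm_triangle_ineq4)
  also have "\<dots> \<le> (1 - \<eta> * \<mu>) * norm ?e + \<eta> * (K * norm (y - ys x))"
  proof (rule add_mono)
    show "norm (?e - \<eta> *\<^sub>R H x y ?e) \<le> (1 - \<eta> * \<mu>) * norm ?e"
      by (rule norm_gradient_step_le[where L=L])
         (use x \<eta> mu_pos nonneg H_linear H_sym H_ge norm_H_le in auto)
    show "norm (\<eta> *\<^sub>R ?r) \<le> \<eta> * (K * norm (y - ys x))"
      using adjoint_residual_le[OF x x, of y] \<eta> by (simp add: norm_minus_commute)
  qed
  finally show ?thesis .
qed

end

section \<open>The Lyapunov function\<close>

text \<open>Convexity of the square, applied to \<open>(1 - c) * e + c * (r / c)\<close>.\<close>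
lemma sq_add_le_convex:
  fixes e r c :: real
  assumes "0 < c" "c \<le> 1" "0 \<le> e'" and e': "e' \<le> (1 - c) * e + r"
  shows "e'\<^sup>2 \<le> (1 - c) * e\<^sup>2 + r\<^sup>2 / c"
proof -
  have "e'\<^sup>2 \<le> ((1 - c) * e + r)\<^sup>2" using assms by (intro power_mono) auto
  also have "\<dots> = (1 - c) * e\<^sup>2 + r\<^sup>2 / c - (1 - c) * c * (e - r / c)\<^sup>2"
    using assms(1) by (simp add: power2_eq_square field_simps)
  also have "\<dots> \<le> (1 - c) * e\<^sup>2 + r\<^sup>2 / c" using assms by simp
  finally show ?thesis .
qed

lemma sq_add_le: "(a + b)\<^sup>2 \<le> 2 * a\<^sup>2 + 2 * (b :: real)\<^sup>2"
  using sum_squares_bound[of a b] by (simp add: power2_sum)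

text \<open>\<open>s\<close> is the length of the step in \<open>x\<close>; \<open>\<delta>\<close> and \<open>\<epsilon>\<close> are the errors in \<open>y\<close> and in \<open>v\<close>. Of the
  \<open>1 / (2 * \<alpha>)\<close> available from the proximal step, the two bounds of \<open>\<alpha>\<close> by a multiple of \<open>\<eta>\<close>
  cost \<open>1 / (8 * \<alpha>)\<close> each; the remaining terms in \<open>s\<^sup>2\<close> have coefficients independent of
  \<open>\<alpha>\<close> and \<open>\<eta>\<close>.\<close>
lemma lyapunov_arith:
  fixes \<mu> \<alpha> \<eta> c L :: real
  assumes pos: "0 < \<mu>" "0 < \<alpha>" "0 < \<eta>" "0 < c" "0 < L"
    and \<eta>_le: "\<eta> \<le> ceta" and \<alpha>1: "\<alpha> \<le> \<mu> / (4 * L\<^sup>2) * \<eta>"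
    and \<alpha>2: "LV \<noteq> 0 \<Longrightarrow> \<alpha> \<le> \<mu> / (16 * LV\<^sup>2) * \<eta>"
    and a: "a * c = 2 + 2 * ceta * K\<^sup>2 / \<mu>"
    and M: "M = Lphi + A\<^sup>2 / 4 + a * B\<^sup>2 / c" "0 \<le> M" and \<alpha>3: "\<alpha> \<le> 1 / (8 * (M + 1))"
    and phi: "\<phi>' \<le> \<phi> - s\<^sup>2 / (2 * \<alpha>) + (A * \<delta> + L * \<epsilon>) * s + Lphi * s\<^sup>2"
    and y: "\<delta>'\<^sup>2 \<le> (1 - c) * \<delta>\<^sup>2 + (B * s)\<^sup>2 / c"
    and v: "\<epsilon>'\<^sup>2 \<le> (1 - \<eta> * \<mu>) * \<epsilon>\<^sup>2 + (\<eta> * (K * \<delta>) + LV * s)\<^sup>2 / (\<eta> * \<mu>)"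
  shows "\<phi>' + a * \<delta>'\<^sup>2 + \<epsilon>'\<^sup>2
    \<le> \<phi> + a * \<delta>\<^sup>2 + \<epsilon>\<^sup>2 - (s\<^sup>2 + \<delta>\<^sup>2 + \<eta> * \<mu> / 2 * \<epsilon>\<^sup>2)"
proof -
  have "0 < ceta" using pos \<eta>_le by linarith
  then have "0 < a * c" using pos unfolding a by (intro add_pos_nonneg) auto
  then have a0: "0 < a" using pos(4) by (simp add: zero_less_mult_iff)
  have em: "0 < \<eta> * \<mu>" using pos by simp
  have 1: "A * \<delta> * s \<le> \<delta>\<^sup>2 + A\<^sup>2 / 4 * s\<^sup>2"
  proof -
    have "0 \<le> (\<delta> - A / 2 * s)\<^sup>2" by simp
    then show ?thesis by (simp add: power2_eq_square algebra_simps)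
  qed
  have 2: "L * \<epsilon> * s \<le> \<eta> * \<mu> / 2 * \<epsilon>\<^sup>2 + s\<^sup>2 / (8 * \<alpha>)"
  proof -
    have "0 \<le> (\<eta> * \<mu> * \<epsilon> - L * s)\<^sup>2 / (2 * (\<eta> * \<mu>))" using em by simp
    also have "\<dots> = \<eta> * \<mu> / 2 * \<epsilon>\<^sup>2 + L\<^sup>2 * s\<^sup>2 / (2 * (\<eta> * \<mu>)) - L * \<epsilon> * s"
      using pos by (simp add: power2_eq_square field_simps)
    finally have "L * \<epsilon> * s \<le> \<eta> * \<mu> / 2 * \<epsilon>\<^sup>2 + (L\<^sup>2 / (2 * (\<eta> * \<mu>))) * s\<^sup>2" by simp
    also have "L\<^sup>2 / (2 * (\<eta> * \<mu>)) \<le> 1 / (8 * \<alpha>)"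
      using \<alpha>1 pos by (simp add: field_simps)
    then have "(L\<^sup>2 / (2 * (\<eta> * \<mu>))) * s\<^sup>2 \<le> 1 / (8 * \<alpha>) * s\<^sup>2"
      by (intro mult_right_mono) auto
    finally show ?thesis by simp
  qed
  have 3: "(\<eta> * (K * \<delta>) + LV * s)\<^sup>2 / (\<eta> * \<mu>) \<le> 2 * ceta * K\<^sup>2 / \<mu> * \<delta>\<^sup>2 + s\<^sup>2 / (8 * \<alpha>)"
  proof -
    have "(\<eta> * (K * \<delta>) + LV * s)\<^sup>2 / (\<eta> * \<mu>)
        \<le> (2 * (\<eta> * (K * \<delta>))\<^sup>2 + 2 * (LV * s)\<^sup>2) / (\<eta> * \<mu>)"
      using em by (intro divide_right_mono sq_add_le) auto
    also have "\<dots> = \<eta> * (2 * K\<^sup>2 / \<mu> * \<delta>\<^sup>2) + 2 * LV\<^sup>2 / (\<eta> * \<mu>) * s\<^sup>2"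
      using pos by (simp add: power2_eq_square field_simps)
    also have "\<dots> \<le> ceta * (2 * K\<^sup>2 / \<mu> * \<delta>\<^sup>2) + 1 / (8 * \<alpha>) * s\<^sup>2"
    proof (intro add_mono mult_right_mono \<eta>_le)
      show "2 * LV\<^sup>2 / (\<eta> * \<mu>) \<le> 1 / (8 * \<alpha>)"
      proof (cases "LV = 0")
        case False
        then have "0 < LV\<^sup>2" by simp
        then show ?thesis using \<alpha>2[OF False] pos by (simp add: field_simps)
      qed (use pos in simp)
    qed (use pos in auto)
    finally show ?thesis by (simp add: mult_ac)
  qed
  have 4: "(M + 1) * s\<^sup>2 \<le> s\<^sup>2 / (8 * \<alpha>)"
  proof -
    have "M + 1 \<le> 1 / (8 * \<alpha>)" using \<alpha>3 pos M(2) by (simp add: field_simps)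
    then have "(M + 1) * s\<^sup>2 \<le> 1 / (8 * \<alpha>) * s\<^sup>2" by (intro mult_right_mono) auto
    then show ?thesis by simp
  qed
  have 5: "a * \<delta>'\<^sup>2 \<le> a * \<delta>\<^sup>2 - (2 + 2 * ceta * K\<^sup>2 / \<mu>) * \<delta>\<^sup>2 + a * B\<^sup>2 / c * s\<^sup>2"
  proof -
    have "a * \<delta>'\<^sup>2 \<le> a * ((1 - c) * \<delta>\<^sup>2 + (B * s)\<^sup>2 / c)" using y a0 by simp
    also have "\<dots> = a * \<delta>\<^sup>2 - (a * c) * \<delta>\<^sup>2 + a * B\<^sup>2 / c * s\<^sup>2"
      by (simp add: power_mult_distrib algebra_simps)
    finally show ?thesis unfolding a .
  qed
  have 6: "s\<^sup>2 / (2 * \<alpha>) = s\<^sup>2 / (8 * \<alpha>) + s\<^sup>2 / (8 * \<alpha>) + s\<^sup>2 / (8 * \<alpha>) + s\<^sup>2 / (8 * \<alpha>)"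
    by (simp add: field_simps)
  have 7: "0 \<le> s\<^sup>2 / (8 * \<alpha>)" using pos by simp
  show ?thesis
    using phi v 1 2 3 4 5 7 unfolding 6 M(1) by (simp add: algebra_simps)
qed

context bilevel_objective
begin

text \<open>\<open>weight \<beta>\<close> is the weight of the squared error in \<open>y\<close> in the Lyapunov function, chosen to
  absorb the terms in this error from the other two components (for \<open>\<eta> \<le> 2 / (\<mu> + L)\<close>).
  \<open>decrease_const \<beta>\<close> collects the coefficients of the squared step length that are independent of
  \<open>\<alpha>\<close> and \<open>\<eta>\<close>, and \<open>alpha_bound \<beta>\<close> is the bound on \<open>\<alpha>\<close> under which
  \<open>1 / (4 * \<alpha>)\<close> outweighs them.\<close>
definition weight :: "real \<Rightarrow> real" where
  "weight \<beta> = (2 + 2 * (2 / (\<mu> + L)) * K\<^sup>2 / \<mu>) / (\<beta> * \<mu>)"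
definition decrease_const :: "real \<Rightarrow> real" where
  "decrease_const \<beta> = Lphi + A\<^sup>2 / 4 + weight \<beta> * (L / \<mu>)\<^sup>2 / (\<beta> * \<mu>)"
definition alpha_bound :: "real \<Rightarrow> real" where
  "alpha_bound \<beta> = 1 / (8 * (decrease_const \<beta> + 1))"

lemma decrease_const_nonneg: "0 < \<beta> \<Longrightarrow> 0 \<le> decrease_const \<beta>"
  using nonneg mu_pos Lphi_nonneg by (auto simp: decrease_const_def weight_def)

lemma alpha_bound_pos: "0 < \<beta> \<Longrightarrow> 0 < alpha_bound \<beta>"
  using decrease_const_nonneg[of \<beta>] by (simp add: alpha_bound_def)

text \<open>The Lyapunov function of one objective; the error in \<open>v\<close> has weight \<open>1\<close>.\<close>
definition lyap :: "real \<Rightarrow> ('a \<Rightarrow> real) \<Rightarrow> 'a \<Rightarrow> 'b \<Rightarrow> 'b \<Rightarrow> real" where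
  "lyap \<beta> g x y w = phi x + g x + weight \<beta> * (norm (y - ys x))\<^sup>2 + (norm (w - vs x))\<^sup>2"

lemma lyap_decrease:
  assumes x: "x \<in> X" "x' \<in> X" and \<beta>: "0 < \<beta>" "\<beta> \<le> 2 / (\<mu> + L)"
    and \<eta>: "0 < \<eta>" "\<eta> \<le> 2 / (\<mu> + L)"
    and \<alpha>: "0 < \<alpha>" "\<alpha> \<le> alpha_bound \<beta>" "\<alpha> \<le> \<mu> / (4 * L\<^sup>2) * \<eta>"
      "LV \<noteq> 0 \<Longrightarrow> \<alpha> \<le> \<mu> / (16 * LV\<^sup>2) * \<eta>"
    and prox: "E x y w (x' - x) + g x' - g x \<le> - (norm (x' - x))\<^sup>2 / (2 * \<alpha>)"
    and y': "y' = y - \<beta> *\<^sub>R G x y" and w': "w' = w - \<eta> *\<^sub>R (H x y w - Q x y)"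
  shows "lyap \<beta> g x' y' w' \<le> lyap \<beta> g x y w
    - ((norm (x' - x))\<^sup>2 + (norm (y - ys x))\<^sup>2 + \<eta> * \<mu> / 2 * (norm (w - vs x))\<^sup>2)"
proof -
  let ?s = "norm (x' - x)"
  have muL: "\<mu> \<le> L" by (rule mu_le_L[OF x(1)])
  have L0: "0 < L" using muL mu_pos by simp
  have le1: "t * \<mu> \<le> 1" if "0 < t" "t \<le> 2 / (\<mu> + L)" for t
  proof -
    have "t * (\<mu> + L) \<le> 2" using that mu_pos L0 by (simp add: field_simps)
    moreover have "t * \<mu> \<le> t * L" using that muL by simp
    ultimately show ?thesis by (simp add: algebra_simps)
  qed
  have ev: "eventually (\<lambda>t. x + t *\<^sub>R (x' - x) \<in> X) (at_right 0)"
    using convex_eventually_ray_in[OF convex_X x(1), of 1 "x' - x"] x(2) by simp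
  have "dphi x (x' - x) - E x y w (x' - x) \<le> (A * norm (y - ys x) + L * norm (w - vs x)) * ?s"
    using E_error[OF x(1) x(1) ev, of y w] by (simp add: norm_minus_commute)
  then have "phi x' + g x' \<le> phi x + g x - ?s\<^sup>2 / (2 * \<alpha>)
      + (A * norm (y - ys x) + L * norm (w - vs x)) * ?s + Lphi * ?s\<^sup>2"
    using phi_descent[OF x] prox by simp
  moreover have "(norm (y' - ys x'))\<^sup>2
      \<le> (1 - \<beta> * \<mu>) * (norm (y - ys x))\<^sup>2 + (L / \<mu> * ?s)\<^sup>2 / (\<beta> * \<mu>)"
  proof (rule sq_add_le_convex)
    have "norm (y' - ys x') \<le> norm (y' - ys x) + norm (ys x' - ys x)"
      using norm_triangle_ineq4[of "y' - ys x" "ys x' - ys x"] by simp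
    then show "norm (y' - ys x') \<le> (1 - \<beta> * \<mu>) * norm (y - ys x) + L / \<mu> * ?s"
      using y_step_contraction[OF x(1) \<beta>, of y] ys_lip[OF x(2,1)] unfolding y' by linarith
  qed (use \<beta> mu_pos le1 in auto)
  moreover have "(norm (w' - vs x'))\<^sup>2 \<le> (1 - \<eta> * \<mu>) * (norm (w - vs x))\<^sup>2
      + (\<eta> * (K * norm (y - ys x)) + LV * ?s)\<^sup>2 / (\<eta> * \<mu>)"
  proof (rule sq_add_le_convex)
    have "norm (w' - vs x') \<le> norm (w' - vs x) + norm (vs x' - vs x)"
      using norm_triangle_ineq4[of "w' - vs x" "vs x' - vs x"] by simp
    then show "norm (w' - vs x') \<le> (1 - \<eta> * \<mu>) * norm (w - vs x)
        + (\<eta> * (K * norm (y - ys x)) + LV * ?s)"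
      using v_step_contraction[OF x(1) \<eta>, of w y] vs_lip[OF x(2,1)] unfolding w' by linarith
  qed (use \<eta> mu_pos le1 in auto)
  ultimately show ?thesis
    unfolding lyap_def
    by (intro lyapunov_arith[where c="\<beta> * \<mu>" and ceta="2 / (\<mu> + L)" and K=K and LV=LV
          and M="decrease_const \<beta>" and A=A and Lphi=Lphi and L=L and B="L / \<mu>" and \<alpha>=\<alpha>])
       (use mu_pos \<alpha> \<eta> \<beta> L0 decrease_const_nonneg in
         \<open>auto simp: weight_def decrease_const_def[symmetric] alpha_bound_def decrease_const_def\<close>)
qed

end

section \<open>Convergence of the errors\<close>

lemma decrements_tendsto_0:
  fixes W D :: "nat \<Rightarrow> real"
  assumes W: "\<And>k. W (Suc k) \<le> W k - D k" and D: "\<And>k. 0 \<le> D k"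
    and r: "strict_mono (r :: nat \<Rightarrow> nat)" and b: "\<And>k. b \<le> W (r k)"
  shows "D \<longlonglongrightarrow> 0"
proof -
  have "W (Suc k) \<le> W k" for k using W[of k] D[of k] by linarith
  then have dec: "decseq W" by (rule decseq_SucI)
  have "b \<le> W k" for k
    using b[of k] decseqD[OF dec seq_suble[OF r, of k]] by linarith
  then obtain w where w: "W \<longlonglongrightarrow> w" using decseq_convergent[OF dec] by metis
  have "(\<lambda>k. W k - W (Suc k)) \<longlonglongrightarrow> w - w"
    by (intro tendsto_diff w LIMSEQ_Suc)
  then have lim: "(\<lambda>k. W k - W (Suc k)) \<longlonglongrightarrow> 0" by simp
  have le: "D k \<le> W k - W (Suc k)" for k using W[of k] by linarith
  show ?thesis
    by (rule tendsto_sandwich[OF _ _ tendsto_const lim]) (use D le in auto)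
qed

context bilevel_objective
begin

text \<open>The objective need not be bounded below on \<open>X\<close>: it converges along the subsequence \<open>r\<close>, and
  this bounds the decreasing Lyapunov function from below.\<close>
lemma errors_tendsto_0:
  assumes xX: "\<And>k. x k \<in> X" and \<beta>: "0 < \<beta>" "\<beta> \<le> 2 / (\<mu> + L)"
    and \<eta>: "0 < \<eta>" "\<eta> \<le> 2 / (\<mu> + L)"
    and \<alpha>: "0 < \<alpha>" "\<alpha> \<le> alpha_bound \<beta>" "\<alpha> \<le> \<mu> / (4 * L\<^sup>2) * \<eta>"
      "LV \<noteq> 0 \<Longrightarrow> \<alpha> \<le> \<mu> / (16 * LV\<^sup>2) * \<eta>"
    and prox: "\<And>k. E (x k) (y k) (w k) (x (Suc k) - x k) + g (x (Suc k)) - g (x k)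
        \<le> - (norm (x (Suc k) - x k))\<^sup>2 / (2 * \<alpha>)"
    and y: "\<And>k. y (Suc k) = y k - \<beta> *\<^sub>R G (x k) (y k)"
    and w: "\<And>k. w (Suc k) = w k - \<eta> *\<^sub>R (H (x k) (y k) (w k) - Q (x k) (y k))"
    and r: "strict_mono r" "(x \<circ> r) \<longlonglongrightarrow> p" and p: "p \<in> X" and g: "continuous_on X g"
  shows "(\<lambda>k. x (Suc k) - x k) \<longlonglongrightarrow> 0" "(\<lambda>k. y k - ys (x k)) \<longlonglongrightarrow> 0"
    "(\<lambda>k. w k - vs (x k)) \<longlonglongrightarrow> 0"
proof -
  define D where "D k = (norm (x (Suc k) - x k))\<^sup>2 + (norm (y k - ys (x k)))\<^sup>2
      + \<eta> * \<mu> / 2 * (norm (w k - vs (x k)))\<^sup>2" for k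
  define W where "W k = lyap \<beta> g (x k) (y k) (w k)" for k
  have cont: "continuous_on X (\<lambda>x. phi x + g x)"
    by (intro continuous_on_add g has_derivative_continuous_on[OF phi_has_derivative])
  have "(\<lambda>k. phi (x (r k)) + g (x (r k))) \<longlonglongrightarrow> phi p + g p"
    using continuous_on_tendsto_compose[OF cont r(2) p] xX by (simp add: o_def)
  then have "Bseq (\<lambda>k. phi (x (r k)) + g (x (r k)))"
    by (intro convergent_imp_Bseq) (auto simp: convergent_def)
  then obtain b where b: "\<And>k. \<bar>phi (x (r k)) + g (x (r k))\<bar> \<le> b"
    by (auto simp: Bseq_def)
  have D: "D \<longlonglongrightarrow> 0"
  proof (rule decrements_tendsto_0[where W=W and b="- b", OF _ _ r(1)])
    show "W (Suc k) \<le> W k - D k" for k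
      unfolding W_def D_def using xX \<beta> \<eta> \<alpha> prox y w by (intro lyap_decrease) auto
    show "0 \<le> D k" for k using \<eta> mu_pos by (simp add: D_def)
    show "- b \<le> W (r k)" for k
    proof -
      have "0 \<le> weight \<beta>" using \<beta> mu_pos nonneg by (simp add: weight_def)
      then have "phi (x (r k)) + g (x (r k)) \<le> W (r k)" by (simp add: W_def lyap_def)
      then show ?thesis using b[of k] by linarith
    qed
  qed
  have *: "z \<longlonglongrightarrow> 0" if "\<And>k. c * (norm (z k))\<^sup>2 \<le> D k" "0 < c"
    for z :: "nat \<Rightarrow> 'c::real_normed_vector" and c
  proof -
    have "(\<lambda>k. (norm (z k))\<^sup>2) \<longlonglongrightarrow> 0"
    proof (rule tendsto_sandwich[of "\<lambda>_. 0" _ _ "\<lambda>k. D k / c"])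
      show "(\<lambda>k. D k / c) \<longlonglongrightarrow> 0" using tendsto_divide[OF D tendsto_const[of c]] that by simp
    qed (use that in \<open>auto simp: field_simps\<close>)
    then have "(\<lambda>k. sqrt ((norm (z k))\<^sup>2)) \<longlonglongrightarrow> sqrt 0" by (rule tendsto_real_sqrt)
    then show ?thesis by (simp add: tendsto_norm_zero_iff)
  qed
  show "(\<lambda>k. x (Suc k) - x k) \<longlonglongrightarrow> 0"
    using \<eta> mu_pos by (intro *[of 1]) (auto simp: D_def)
  show "(\<lambda>k. y k - ys (x k)) \<longlonglongrightarrow> 0"
    using \<eta> mu_pos by (intro *[of 1]) (auto simp: D_def)
  show "(\<lambda>k. w k - vs (x k)) \<longlonglongrightarrow> 0"
    using \<eta> mu_pos by (intro *[of "\<eta> * \<mu> / 2"]) (auto simp: D_def)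
qed

lemma tendsto_of_lipschitz_error:
  assumes lip: "\<And>x x'. x \<in> X \<Longrightarrow> x' \<in> X \<Longrightarrow> norm (h x - h x') \<le> c * norm (x - x')"
    and x: "\<And>k. x k \<in> X" "x \<longlonglongrightarrow> p" and p: "p \<in> X" and u: "(\<lambda>k. u k - h (x k)) \<longlonglongrightarrow> 0"
  shows "u \<longlonglongrightarrow> (h p :: 'c::real_normed_vector)"
proof -
  have "(\<lambda>k. norm (x k - p)) \<longlonglongrightarrow> 0" using x(2) LIM_zero tendsto_norm_zero by blast
  then have "(\<lambda>k. c * norm (x k - p)) \<longlonglongrightarrow> 0" by (rule tendsto_mult_right_zero)
  then have "(\<lambda>k. h (x k) - h p) \<longlonglongrightarrow> 0"
    by (rule Lim_null_comparison[rotated]) (use lip x p in auto)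
  then have "(\<lambda>k. (u k - h (x k)) + (h (x k) - h p)) \<longlonglongrightarrow> 0 + 0" using u by (intro tendsto_add)
  then show ?thesis by (simp add: LIM_zero_iff)
qed

lemma E_tendsto:
  assumes x: "\<And>k. x k \<in> X" "x \<longlonglongrightarrow> p" and p: "p \<in> X"
    and y: "(\<lambda>k. y k - ys (x k)) \<longlonglongrightarrow> 0" and w: "(\<lambda>k. w k - vs (x k)) \<longlonglongrightarrow> 0"
    and d: "d \<longlonglongrightarrow> d0"
  shows "(\<lambda>k. E (x k) (y k) (w k) (d k)) \<longlonglongrightarrow> dphi p d0"
proof -
  define \<rho> where "\<rho> k = norm (x k - p) + norm (y k - ys p)" for k
  have yl: "y \<longlonglongrightarrow> ys p" by (rule tendsto_of_lipschitz_error[OF ys_lip x p y])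
  have wl: "w \<longlonglongrightarrow> vs p" by (rule tendsto_of_lipschitz_error[OF vs_lip x p w])
  have "(\<lambda>k. norm (x k - p)) \<longlonglongrightarrow> 0" "(\<lambda>k. norm (y k - ys p)) \<longlonglongrightarrow> 0"
    using x(2) yl by (auto intro!: tendsto_norm_zero LIM_zero)
  then have \<rho>: "\<rho> \<longlonglongrightarrow> 0" unfolding \<rho>_def using tendsto_add_zero by blast
  have "(\<lambda>k. P (x k) (y k) - P p (ys p)) \<longlonglongrightarrow> 0"
    by (rule Lim_null_comparison[OF _ tendsto_mult_right_zero[OF \<rho>, of LP]])
       (use P_lip[OF x(1) p] in \<open>auto simp: \<rho>_def\<close>)
  then have Pl: "(\<lambda>k. P (x k) (y k)) \<longlonglongrightarrow> P p (ys p)" by (simp add: LIM_zero_iff)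
  have "bounded_linear (J p (ys p))"
    using J_linear[OF p] by (simp add: linear_conv_bounded_linear)
  then have Jp: "(\<lambda>k. J p (ys p) (d k)) \<longlonglongrightarrow> J p (ys p) d0"
    using d by (rule bounded_linear.tendsto)
  have "(\<lambda>k. LJ * \<rho> k * norm (d k)) \<longlonglongrightarrow> LJ * 0 * norm d0"
    by (intro tendsto_intros \<rho> d)
  then have "(\<lambda>k. LJ * \<rho> k * norm (d k)) \<longlonglongrightarrow> 0" by simp
  then have "(\<lambda>k. J (x k) (y k) (d k) - J p (ys p) (d k)) \<longlonglongrightarrow> 0"
    by (rule Lim_null_comparison[rotated]) (use J_lip[OF x(1) p] in \<open>auto simp: \<rho>_def\<close>)
  from tendsto_add[OF this Jp] have Jl: "(\<lambda>k. J (x k) (y k) (d k)) \<longlonglongrightarrow> J p (ys p) d0" by simp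
  show ?thesis unfolding E_def dphi_def by (intro tendsto_intros Pl Jl wl d)
qed

lemma limit_point_estimates:
  assumes xX: "\<And>k. x k \<in> X" and \<beta>: "0 < \<beta>" "\<beta> \<le> 2 / (\<mu> + L)"
    and \<eta>: "0 < \<eta>" "\<eta> \<le> 2 / (\<mu> + L)"
    and \<alpha>: "0 < \<alpha>" "\<alpha> \<le> alpha_bound \<beta>" "\<alpha> \<le> \<mu> / (4 * L\<^sup>2) * \<eta>"
      "LV \<noteq> 0 \<Longrightarrow> \<alpha> \<le> \<mu> / (16 * LV\<^sup>2) * \<eta>"
    and prox: "\<And>k. E (x k) (y k) (w k) (x (Suc k) - x k) + g (x (Suc k)) - g (x k)
        \<le> - (norm (x (Suc k) - x k))\<^sup>2 / (2 * \<alpha>)"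
    and y: "\<And>k. y (Suc k) = y k - \<beta> *\<^sub>R G (x k) (y k)"
    and w: "\<And>k. w (Suc k) = w k - \<eta> *\<^sub>R (H (x k) (y k) (w k) - Q (x k) (y k))"
    and r: "strict_mono r" "(x \<circ> r) \<longlonglongrightarrow> p" and p: "p \<in> X" and g: "continuous_on X g"
  shows "(\<lambda>k. x (Suc (r k))) \<longlonglongrightarrow> p"
    and "d \<longlonglongrightarrow> d0 \<Longrightarrow> (\<lambda>k. E (x (r k)) (y (r k)) (w (r k)) (d k)) \<longlonglongrightarrow> dphi p d0"
proof -
  note err = errors_tendsto_0[OF assms]
  have sub: "(\<lambda>k. z (r k)) \<longlonglongrightarrow> 0" if "z \<longlonglongrightarrow> 0" for z :: "nat \<Rightarrow> 'c::real_normed_vector"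
    using LIMSEQ_subseq_LIMSEQ[OF that r(1)] by (simp add: o_def)
  have xr: "(\<lambda>k. x (r k)) \<longlonglongrightarrow> p" using r(2) by (simp add: o_def)
  from tendsto_add[OF sub[OF err(1)] xr] show "(\<lambda>k. x (Suc (r k))) \<longlonglongrightarrow> p" by simp
  show "(\<lambda>k. E (x (r k)) (y (r k)) (w (r k)) (d k)) \<longlonglongrightarrow> dphi p d0" if "d \<longlonglongrightarrow> d0"
    by (rule E_tendsto[OF xX xr p sub[OF err(2)] sub[OF err(3)] that])
qed

end

section \<open>Directional derivatives of convex functions\<close>

text \<open>The difference quotient is nondecreasing in \<open>t\<close> and bounded below by a backward slope, hence
  converges to its infimum.\<close>
lemma convex_on_ray_derivative_exists:
  fixes g :: "'a::real_normed_vector \<Rightarrow> real"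
  assumes g: "convex_on S g" and S: "open S" "p \<in> S"
  shows "\<exists>l. ((\<lambda>t. (g (p + t *\<^sub>R d) - g p) / t) \<longlongrightarrow> l) (at_right 0)"
proof -
  have "((\<lambda>t::real. p + t *\<^sub>R d) \<longlongrightarrow> p + 0 *\<^sub>R d) (at 0)" by (intro tendsto_intros)
  then have "eventually (\<lambda>t. p + t *\<^sub>R d \<in> S) (at (0::real))"
    using S by (auto simp: tendsto_def)
  then obtain e where e: "e > 0" and eS: "\<And>t::real. \<bar>t\<bar> < e \<Longrightarrow> p + t *\<^sub>R d \<in> S"
    unfolding eventually_at using S(2) by (auto simp: dist_real_def)
      (metis add.right_neutral scale_zero_left)
  define c where "c t = g (p + t *\<^sub>R d)" for t
  have c: "convex_on {-e<..<e} c"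
  proof (rule convex_onI)
    fix t a b :: real assume t: "0 < t" "t < 1" and ab: "a \<in> {-e<..<e}" "b \<in> {-e<..<e}"
    have "p + ((1 - t) *\<^sub>R a + t *\<^sub>R b) *\<^sub>R d = (1 - t) *\<^sub>R (p + a *\<^sub>R d) + t *\<^sub>R (p + b *\<^sub>R d)"
      by (simp add: algebra_simps)
    then show "c ((1 - t) *\<^sub>R a + t *\<^sub>R b) \<le> (1 - t) * c a + t * c b"
      unfolding c_def using convex_onD[OF g, of t "p + a *\<^sub>R d" "p + b *\<^sub>R d"] t ab eS by auto
  qed auto
  define q where "q t = (c t - c 0) / t" for t
  have mono: "q s \<le> q t" if "0 < s" "s \<le> t" "t < e" for s t
    using convex_on_slope_le(1)[OF c, of 0 t s] that e
    by (cases "s = t") (auto simp: q_def minus_divide_left[symmetric] divide_simps algebra_simps)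
  have low: "(c 0 - c (- (e/2))) / (e/2) \<le> q t" if "0 < t" "t < e" for t
    using convex_on_slope_le[OF c, of "- (e/2)" t 0] that e
    by (force simp: q_def divide_simps algebra_simps)
  define l where "l = Inf (q ` {0<..<e})"
  have bdd: "bdd_below (q ` {0<..<e})" using low by (intro bdd_belowI2) auto
  have "(q \<longlongrightarrow> l) (at_right 0)"
  proof (rule order_tendstoI)
    fix a assume "a < l"
    moreover have "l \<le> q t" if "0 < t" "t < e" for t
      unfolding l_def using bdd that by (intro cINF_lower) auto
    ultimately show "eventually (\<lambda>t. a < q t) (at_right 0)"
      using e by (intro eventually_at_rightI[of 0 e]) force+
  next
    fix a assume "l < a"
    then obtain s where s: "0 < s" "s < e" "q s < a"
      using cINF_less_iff[OF _ bdd, of a] e by (auto simp: l_def)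
    show "eventually (\<lambda>t. q t < a) (at_right 0)"
    proof (rule eventually_at_rightI[OF _ s(1)])
      fix t assume "t \<in> {0<..<s}"
      then show "q t < a" using mono[of t s] s by auto
    qed
  qed
  moreover have "q = (\<lambda>t. (g (p + t *\<^sub>R d) - g p) / t)" by (simp add: q_def c_def fun_eq_iff)
  ultimately show ?thesis by auto
qed

section \<open>Passing to the limit in the proximal subproblem\<close>

text \<open>\<open>x k\<close> is the current point, \<open>x' k\<close> the solution of the proximal subproblem there, and \<open>e i k\<close>
  the linear form that models the smooth part of objective \<open>i\<close>. When both points tend to \<open>p\<close> and
  the models converge, \<open>p\<close> solves its own proximal subproblem.\<close>
lemma proximal_optimality_limit:
  fixes e :: "'m::finite \<Rightarrow> nat \<Rightarrow> 'a::real_normed_vector \<Rightarrow> real" and D :: "'m \<Rightarrow> 'a \<Rightarrow> real"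
  assumes opt: "\<And>k u. u \<in> X \<Longrightarrow>
      Max (range (\<lambda>i. e i k (x' k - x k) + g i (x' k) - g i (x k))) + c * (norm (x' k - x k))\<^sup>2
      \<le> Max (range (\<lambda>i. e i k (u - x k) + g i u - g i (x k))) + c * (norm (u - x k))\<^sup>2"
    and c: "0 \<le> c" and x: "\<And>k. x k \<in> X" "x \<longlonglongrightarrow> p" and x': "\<And>k. x' k \<in> X" "x' \<longlonglongrightarrow> p"
    and e: "\<And>i d d0. d \<longlonglongrightarrow> d0 \<Longrightarrow> (\<lambda>k. e i k (d k)) \<longlonglongrightarrow> D i d0"
    and D0: "\<And>i. D i 0 = 0"
    and g: "\<And>i. continuous_on X (g i)" and p: "p \<in> X" and u: "u \<in> X"
  shows "\<exists>j. 0 \<le> D j (u - p) + g j u - g j p + c * (norm (u - p))\<^sup>2"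
proof (rule ccontr)
  assume "\<not> ?thesis"
  then have neg: "D j (u - p) + g j u - g j p + c * (norm (u - p))\<^sup>2 < 0" for j
    by (auto simp: not_le)
  obtain i :: 'm where True by simp
  have gx: "(\<lambda>k. g j (x k)) \<longlonglongrightarrow> g j p" "(\<lambda>k. g j (x' k)) \<longlonglongrightarrow> g j p" for j
    by (rule continuous_on_tendsto_compose[OF g]; use x x' p in simp)+
  have "(\<lambda>k. e j k (u - x k) + g j u - g j (x k) + c * (norm (u - x k))\<^sup>2
        - (e i k (x' k - x k) + g i (x' k) - g i (x k)))
      \<longlonglongrightarrow> D j (u - p) + g j u - g j p + c * (norm (u - p))\<^sup>2 - (D i (p - p) + g i p - g i p)" for j
    by (intro tendsto_intros e gx x x')
  then have "eventually (\<lambda>k. e j k (u - x k) + g j u - g j (x k) + c * (norm (u - x k))\<^sup>2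
        - (e i k (x' k - x k) + g i (x' k) - g i (x k)) < 0) sequentially" for j
    using neg[of j] by (intro order_tendstoD(2)) (auto simp: D0)
  then have "eventually (\<lambda>k. \<forall>j. e j k (u - x k) + g j u - g j (x k) + c * (norm (u - x k))\<^sup>2
        - (e i k (x' k - x k) + g i (x' k) - g i (x k)) < 0) sequentially"
    by (simp add: eventually_all_finite)
  then obtain k where k: "\<And>j. e j k (u - x k) + g j u - g j (x k) + c * (norm (u - x k))\<^sup>2
        < e i k (x' k - x k) + g i (x' k) - g i (x k)"
    unfolding eventually_sequentially by (force simp: less_diff_eq)
  have "Max (range (\<lambda>i. e i k (u - x k) + g i u - g i (x k)))
      \<in> range (\<lambda>i. e i k (u - x k) + g i u - g i (x k))"
    by (rule Max_in) auto
  then obtain j where j: "Max (range (\<lambda>i. e i k (u - x k) + g i u - g i (x k)))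
      = e j k (u - x k) + g j u - g j (x k)" by (rule rangeE)
  have "e i k (x' k - x k) + g i (x' k) - g i (x k)
      \<le> Max (range (\<lambda>i. e i k (x' k - x k) + g i (x' k) - g i (x k)))"
    by (rule Max_ge) auto
  also have "\<dots> \<le> Max (range (\<lambda>i. e i k (x' k - x k) + g i (x' k) - g i (x k)))
      + c * (norm (x' k - x k))\<^sup>2" using c by simp
  also have "\<dots> \<le> e j k (u - x k) + g j u - g j (x k) + c * (norm (u - x k))\<^sup>2"
    using opt[OF u, of k] unfolding j .
  also have "\<dots> < e i k (x' k - x k) + g i (x' k) - g i (x k)" by (rule k)
  finally show False by simp
qed

section \<open>Pareto stationarity\<close>

lemma dir_deriv_infeasible:
  assumes p: "p \<in> X" and no: "\<And>t. 0 < t \<Longrightarrow> p + t *\<^sub>R d \<notin> X"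
  shows "dir_deriv (bilevel_obj X f F g i) p d = \<infinity>"
  unfolding dir_deriv_def
proof (rule tendsto_Lim)
  show "((\<lambda>t. (bilevel_obj X f F g i (p + t *\<^sub>R d) - bilevel_obj X f F g i p) / ereal t) \<longlongrightarrow> \<infinity>)
      (at_right 0)"
  proof (rule tendsto_eventually)
    show "\<forall>\<^sub>F t in at_right 0.
        (bilevel_obj X f F g i (p + t *\<^sub>R d) - bilevel_obj X f F g i p) / ereal t = \<infinity>"
      using eventually_at_right_less[of 0]
      by eventually_elim (use p no in \<open>auto simp: bilevel_obj_def\<close>)
  qed
qed simp

lemma dir_deriv_feasible:
  assumes p: "p \<in> X" and feas: "eventually (\<lambda>t. p + t *\<^sub>R d \<in> X) (at_right 0)"
    and F: "((\<lambda>x. F i x (y_star f x)) has_derivative D) (at p within X)"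
    and g: "((\<lambda>t. (g i (p + t *\<^sub>R d) - g i p) / t) \<longlongrightarrow> l) (at_right 0)"
  shows "dir_deriv (bilevel_obj X f F g i) p d = ereal (D d + l)"
  unfolding dir_deriv_def
proof (rule tendsto_Lim)
  have "((\<lambda>t. ereal ((F i (p + t *\<^sub>R d) (y_star f (p + t *\<^sub>R d)) - F i p (y_star f p)) /\<^sub>R t
      + (g i (p + t *\<^sub>R d) - g i p) / t)) \<longlongrightarrow> ereal (D d + l)) (at_right 0)"
    by (intro tendsto_intros has_derivative_ray_limit[OF F feas] g)
  moreover have "eventually (\<lambda>t. ereal ((F i (p + t *\<^sub>R d) (y_star f (p + t *\<^sub>R d)) - F i p (y_star f p)) /\<^sub>R t
      + (g i (p + t *\<^sub>R d) - g i p) / t)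
      = (bilevel_obj X f F g i (p + t *\<^sub>R d) - bilevel_obj X f F g i p) / ereal t) (at_right 0)"
    using feas eventually_at_right_less[of 0]
    by eventually_elim (use p in \<open>simp add: bilevel_obj_def field_simps\<close>)
  ultimately show "((\<lambda>t. (bilevel_obj X f F g i (p + t *\<^sub>R d) - bilevel_obj X f F g i p) / ereal t)
      \<longlongrightarrow> ereal (D d + l)) (at_right 0)"
    by (rule Lim_transform_eventually)
qed simp

text \<open>Testing the proximal condition with \<open>u = p + t *\<^sub>R d\<close> and dividing by \<open>t\<close> makes the quadratic
  term vanish as \<open>t\<close> tends to \<open>0\<close>. If no such point is feasible, the directional derivatives are
  infinite.\<close>
lemma pareto_stationaryI_proximal:
  fixes F :: "'m::finite \<Rightarrow> real^'n1 \<Rightarrow> real^'n2 \<Rightarrow> real" and D :: "'m \<Rightarrow> real^'n1 \<Rightarrow> real"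
  assumes X: "convex X" "p \<in> X" and c: "0 \<le> c"
    and F: "\<And>i. ((\<lambda>x. F i x (y_star f x)) has_derivative D i) (at p within X)"
    and S: "open S" "X \<subseteq> S" and g: "\<And>i. convex_on S (g i)"
    and opt: "\<And>u. u \<in> X \<Longrightarrow> \<exists>j. 0 \<le> D j (u - p) + g j u - g j p + c * (norm (u - p))\<^sup>2"
  shows "pareto_stationary X f F g p"
  unfolding pareto_stationary_def
proof (intro conjI allI)
  show "p \<in> X" by fact
  fix d
  have "\<exists>i. 0 \<le> dir_deriv (bilevel_obj X f F g i) p d"
  proof (cases "\<exists>\<tau>>0. p + \<tau> *\<^sub>R d \<in> X")
    case False
    then have "dir_deriv (bilevel_obj X f F g i) p d = \<infinity>" for i
      by (intro dir_deriv_infeasible[OF X(2)]) auto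
    then show ?thesis by simp
  next
    case True
    then obtain \<tau> where \<tau>: "\<tau> > 0" "p + \<tau> *\<^sub>R d \<in> X" by blast
    have feas: "eventually (\<lambda>t. p + t *\<^sub>R d \<in> X) (at_right 0)"
      by (rule convex_eventually_ray_in[OF X \<tau>(2,1)])
    have "\<exists>l. \<forall>i. ((\<lambda>t. (g i (p + t *\<^sub>R d) - g i p) / t) \<longlongrightarrow> l i) (at_right 0)"
      using X S by (intro choice allI convex_on_ray_derivative_exists[OF g S(1)]) auto
    then obtain l where l: "\<And>i. ((\<lambda>t. (g i (p + t *\<^sub>R d) - g i p) / t) \<longlongrightarrow> l i) (at_right 0)"
      by blast
    have "\<exists>i. 0 \<le> D i d + l i"
    proof (rule ccontr)
      assume "\<not> ?thesis"
      then have neg: "D i d + l i < 0" for i by (auto simp: not_le)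
      have "((\<lambda>t. D i d + (g i (p + t *\<^sub>R d) - g i p) / t + c * (t * (norm d)\<^sup>2))
          \<longlongrightarrow> D i d + l i + c * (0 * (norm d)\<^sup>2)) (at_right 0)" for i
        by (intro tendsto_intros l)
      then have "eventually (\<lambda>t. D i d + (g i (p + t *\<^sub>R d) - g i p) / t + c * (t * (norm d)\<^sup>2) < 0)
          (at_right 0)" for i
        using neg[of i] by (intro order_tendstoD(2)) auto
      then have "eventually (\<lambda>t. \<forall>i. D i d + (g i (p + t *\<^sub>R d) - g i p) / t + c * (t * (norm d)\<^sup>2) < 0)
          (at_right 0)"
        by (simp add: eventually_all_finite)
      with feas eventually_at_right_less[of 0]
      have "eventually (\<lambda>t. (p + t *\<^sub>R d \<in> X \<and> 0 < t) \<and>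
          (\<forall>i. D i d + (g i (p + t *\<^sub>R d) - g i p) / t + c * (t * (norm d)\<^sup>2) < 0)) (at_right 0)"
        by (intro eventually_conj)
      then obtain t where t: "p + t *\<^sub>R d \<in> X" "0 < t"
        and lt: "\<And>i. D i d + (g i (p + t *\<^sub>R d) - g i p) / t + c * (t * (norm d)\<^sup>2) < 0"
        by (metis (no_types, lifting) eventually_happens trivial_limit_at_right_real)
      obtain j where "0 \<le> D j (t *\<^sub>R d) + g j (p + t *\<^sub>R d) - g j p + c * (norm (t *\<^sub>R d))\<^sup>2"
        using opt[OF t(1)] by auto
      also have "D j (t *\<^sub>R d) = t * D j d"
        using linear_scale[OF has_derivative_linear[OF F]] by simp
      also have "t * D j d + g j (p + t *\<^sub>R d) - g j p + c * (norm (t *\<^sub>R d))\<^sup>2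
          = t * (D j d + (g j (p + t *\<^sub>R d) - g j p) / t + c * (t * (norm d)\<^sup>2))"
        using t(2) by (simp add: power2_eq_square field_simps)
      finally show False using lt[of j] t(2) by (simp add: zero_le_mult_iff)
    qed
    then obtain i where "0 \<le> D i d + l i" ..
    moreover have "dir_deriv (bilevel_obj X f F g i) p d = ereal (D i d + l i)"
      by (rule dir_deriv_feasible) (rule X(2) feas F l)+
    ultimately show ?thesis by (intro exI[of _ i]) simp
  qed
  then show "0 \<le> Max (range (\<lambda>i. dir_deriv (bilevel_obj X f F g i) p d))"
    by (subst Max_ge_iff) auto
qed

section \<open>Gradients and second derivatives on the product space\<close>

lemma gradient_has_derivative:
  assumes "h differentiable (at z)"
  shows "(h has_derivative (\<lambda>d. gradient h z \<bullet> d)) (at z)"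
proof -
  let ?D = "frechet_derivative h (at z)"
  have D: "(h has_derivative ?D) (at z)" using assms frechet_derivative_works by blast
  have "gradient h z \<bullet> d = ?D d" for d
  proof -
    have "?D d = ?D (\<Sum>b\<in>Basis. (d \<bullet> b) *\<^sub>R b)" by (simp add: euclidean_representation)
    also have "\<dots> = gradient h z \<bullet> d"
      using has_derivative_linear[OF D]
      by (simp add: linear_sum linear_scale gradient_def inner_sum_left inner_commute[of d] mult.commute)
    finally show ?thesis by simp
  qed
  then show ?thesis using D by simp
qed

lemma gradient_eqI:
  assumes "(h has_derivative (\<lambda>d. g \<bullet> d)) (at z)"
  shows "gradient h z = g"
proof -
  have "h differentiable (at z)" using assms by (rule differentiableI)
  then have "(\<lambda>d. gradient h z \<bullet> d) = (\<lambda>d. g \<bullet> d)"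
    using has_derivative_unique[OF gradient_has_derivative assms] by blast
  then have "gradient h z \<bullet> (gradient h z - g) = g \<bullet> (gradient h z - g)" by meson
  then have "(gradient h z - g) \<bullet> (gradient h z - g) = 0" by (simp add: inner_diff_left)
  then show ?thesis by simp
qed

lemma gradient_prod:
  assumes "case_prod h differentiable (at (x, y))"
  shows "gradient (case_prod h) (x, y) = (grad_x h x y, grad_y h x y)"
    and "(h x has_derivative (\<lambda>d. grad_y h x y \<bullet> d)) (at y)"
proof -
  let ?g = "gradient (case_prod h) (x, y)"
  have h: "(case_prod h has_derivative (\<lambda>d. ?g \<bullet> d)) (at (x, y))"
    using assms by (rule gradient_has_derivative)
  have "((\<lambda>x'. (x', y)) has_derivative (\<lambda>d. (d, 0))) (at x)"
    by (auto intro!: derivative_eq_intros)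
  from has_derivative_compose[OF this h]
  have "((\<lambda>x'. h x' y) has_derivative (\<lambda>d. fst ?g \<bullet> d)) (at x)"
    by (simp add: inner_prod_def)
  then have gx: "grad_x h x y = fst ?g" unfolding grad_x_def by (rule gradient_eqI)
  have "((\<lambda>y'. (x, y')) has_derivative (\<lambda>d. (0, d))) (at y)"
    by (auto intro!: derivative_eq_intros)
  from has_derivative_compose[OF this h]
  have hy: "(h x has_derivative (\<lambda>d. snd ?g \<bullet> d)) (at y)"
    by (simp add: inner_prod_def)
  then have gy: "grad_y h x y = snd ?g" unfolding grad_y_def by (rule gradient_eqI)
  show "?g = (grad_x h x y, grad_y h x y)" by (simp add: gx gy)
  show "(h x has_derivative (\<lambda>d. grad_y h x y \<bullet> d)) (at y)" using hy by (simp add: gy)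
qed

lemma inner_matrix_vector_transpose: "(A *v v) \<bullet> (d :: real^'n) = v \<bullet> (transpose A *v d)"
  by (metis dot_lmul_matrix inner_commute vector_transpose_matrix)

text \<open>The derivative of \<open>grad_y f\<close> in both variables, and its block in \<open>x\<close> as a part of the second
  derivative of \<open>f\<close>. The open neighbourhood in \<open>C2_on\<close> is needed because \<open>grad_y\<close> is the
  component of the gradient only where \<open>f\<close> is differentiable.\<close>
lemma second_deriv_grad_y:
  assumes f: "C2_on (case_prod f) S" and z: "(x, y) \<in> S"
  shows "((\<lambda>z. grad_y f (fst z) (snd z)) has_derivative
      (\<lambda>d. transpose (hess_xy f x y) *v fst d + hess_yy f x y *v snd d)) (at (x, y))"
    and "transpose (hess_xy f x y) *v d = snd (second_deriv (case_prod f) (x, y) (d, 0))"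
proof -
  let ?G = "\<lambda>z. grad_y f (fst z) (snd z)"
  let ?D = "\<lambda>d. snd (second_deriv (case_prod f) (x, y) d)"
  obtain U where U: "open U" "S \<subseteq> U" "\<And>z. z \<in> U \<Longrightarrow> case_prod f differentiable (at z)"
    using f by (auto simp: C2_on_def)
  have "gradient (case_prod f) differentiable (at (x, y))" using f z by (auto simp: C2_on_def)
  then have "(gradient (case_prod f) has_derivative second_deriv (case_prod f) (x, y)) (at (x, y))"
    unfolding second_deriv_def by (simp add: frechet_derivative_works)
  then have "((\<lambda>z. snd (gradient (case_prod f) z)) has_derivative ?D) (at (x, y))"
    by (rule has_derivative_snd)
  then have G: "(?G has_derivative ?D) (at (x, y))"
  proof (rule has_derivative_transform_within_open[OF _ U(1)])
    show "(x, y) \<in> U" using U(2) z by blast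
    show "snd (gradient (case_prod f) z) = ?G z" if "z \<in> U" for z
      using gradient_prod(1)[of f "fst z" "snd z"] U(3)[OF that] by simp
  qed
  interpret D: bounded_linear ?D using G by (rule has_derivative_bounded_linear)
  have "((\<lambda>x'. (x', y)) has_derivative (\<lambda>d. (d, 0))) (at x)"
    by (auto intro!: derivative_eq_intros)
  from has_derivative_compose[OF this G]
  have "((\<lambda>x'. grad_y f x' y) has_derivative (\<lambda>d. ?D (d, 0))) (at x)" by simp
  moreover from this have "((\<lambda>x'. grad_y f x' y) has_derivative
      (\<lambda>d. transpose (hess_xy f x y) *v d)) (at x)"
    unfolding hess_xy_def transpose_transpose
    using jacobian_works[of "\<lambda>x'. grad_y f x' y" "at x"] differentiableI by blast
  ultimately have xy: "transpose (hess_xy f x y) *v d = ?D (d, 0)" for d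
    by (blast dest: has_derivative_unique[THEN fun_cong])
  have "((\<lambda>y'. (x, y')) has_derivative (\<lambda>d. (0, d))) (at y)"
    by (auto intro!: derivative_eq_intros)
  from has_derivative_compose[OF this G]
  have "(grad_y f x has_derivative (\<lambda>d. ?D (0, d))) (at y)" by simp
  moreover from this have "(grad_y f x has_derivative (\<lambda>d. hess_yy f x y *v d)) (at y)"
    unfolding hess_yy_def using jacobian_works[of "grad_y f x" "at y"] differentiableI by blast
  ultimately have yy: "hess_yy f x y *v d = ?D (0, d)" for d
    by (blast dest: has_derivative_unique[THEN fun_cong])
  have "?D d = transpose (hess_xy f x y) *v fst d + hess_yy f x y *v snd d" for d
    using D.add[of "(fst d, 0)" "(0, snd d)"] unfolding xy yy by simp
  then show "(?G has_derivative
      (\<lambda>d. transpose (hess_xy f x y) *v fst d + hess_yy f x y *v snd d)) (at (x, y))"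
    using G by (simp add: fun_eq_iff)
  show "transpose (hess_xy f x y) *v d = ?D (d, 0)" by (rule xy)
qed

lemma lipschitz_on_prodD:
  assumes "L-lipschitz_on (X \<times> UNIV) h" "x \<in> X" "x' \<in> X"
  shows "norm (h (x, y) - h (x', y')) \<le> L * (norm (x - x') + norm (y - y'))"
proof -
  have "norm (h (x, y) - h (x', y')) \<le> L * dist (x, y) (x', y')"
    using lipschitz_onD[OF assms(1), of "(x, y)" "(x', y')"] assms(2,3) by (simp add: dist_norm)
  also have "\<dots> \<le> L * (norm (x - x') + norm (y - y'))"
    using norm_Pair_le[of "x - x'" "y - y'"] lipschitz_on_nonneg[OF assms(1)]
    by (intro mult_left_mono) (auto simp: dist_norm)
  finally show ?thesis .
qed

section \<open>Limit points of the method\<close>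

text \<open>The standing assumptions on the data give an instance of \<open>bilevel_objective\<close> for each
  upper-level objective.\<close>
lemma bilevel_objective_standing:
  fixes X :: "(real^'n1) set" and f :: "real^'n1 \<Rightarrow> real^'n2 \<Rightarrow> real"
    and F :: "real^'n1 \<Rightarrow> real^'n2 \<Rightarrow> real"
  assumes X: "convex X" "X \<noteq> {}"
    and strong: "\<mu> > 0" "\<And>x. x \<in> X \<Longrightarrow> strongly_convex \<mu> (f x)"
    and f_C2: "C2_on (case_prod f) (X \<times> UNIV)"
    and f_lip2: "lipschitz_second_deriv_on LJ (X \<times> UNIV) (case_prod f)"
    and F_C1: "C1_on (case_prod F) (X \<times> UNIV)"
    and F_lip: "LP-lipschitz_on (X \<times> UNIV) (gradient (case_prod F))"
    and C_Fy: "\<And>x y. x \<in> X \<Longrightarrow> norm (grad_y F x y) \<le> C_Fy"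
    and L_Fy: "L_Fy-lipschitz_on (X \<times> UNIV) (\<lambda>(x, y). grad_y F x y)"
    and L_fy: "L_fy-lipschitz_on (X \<times> UNIV) (\<lambda>(x, y). grad_y f x y)"
    and L_fyy: "lipschitz_matrix_on L_fyy (X \<times> UNIV) (\<lambda>(x, y). hess_yy f x y)"
  shows "bilevel_objective X (grad_y f) (\<lambda>x y w. hess_yy f x y *v w)
    (\<lambda>x y d. transpose (hess_xy f x y) *v d) (y_star f) F (grad_x F) (grad_y F)
    \<mu> L_fy L_fyy LJ LP L_Fy C_Fy"
proof (rule bilevel_objective.intro)
  have fd: "case_prod f differentiable (at (x, y))" if "x \<in> X" for x y
    using f_C2 that by (force simp: C2_on_def)
  have Fd: "case_prod F differentiable (at (x, y))" if "x \<in> X" for x y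
    using F_C1 that by (auto simp: C1_on_def)
  have fy: "(f x has_derivative (\<lambda>d. grad_y f x y \<bullet> d)) (at y)" if "x \<in> X" for x y
    by (rule gradient_prod(2)[OF fd[OF that]])
  have dist_le: "dist (x, y) (x', y') \<le> norm (x - x') + norm (y - y')"
    for x x' :: "real^'n1" and y y' :: "real^'n2"
    using norm_Pair_le[of "x - x'" "y - y'"] by (simp add: dist_norm)
  show "convex X" "0 < \<mu>" by fact+
  show "0 \<le> L_fy" using lipschitz_on_nonneg[OF L_fy] .
  show LH0: "0 \<le> L_fyy" using L_fyy by (simp add: lipschitz_matrix_on_def)
  show LJ0: "0 \<le> LJ" using f_lip2 by (simp add: lipschitz_second_deriv_on_def)
  show "0 \<le> LP" using lipschitz_on_nonneg[OF F_lip] .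
  show "0 \<le> L_Fy" using lipschitz_on_nonneg[OF L_Fy] .
  obtain x0 where "x0 \<in> X" using X(2) by blast
  then show "0 \<le> C_Fy" using C_Fy[of x0 0] norm_ge_zero order_trans by blast
  fix x assume x: "x \<in> X"
  show G: "((\<lambda>z. grad_y f (fst z) (snd z)) has_derivative
      (\<lambda>d. transpose (hess_xy f x y) *v fst d + hess_yy f x y *v snd d)) (at (x, y))" for y
    by (rule second_deriv_grad_y(1)[OF f_C2]) (use x in auto)
  show "linear (\<lambda>w. hess_yy f x y *v w)" for y by (rule matrix_vector_mul_linear)
  show "linear (\<lambda>d. transpose (hess_xy f x y) *v d)" for y by (rule matrix_vector_mul_linear)
  show "\<mu> * (norm (u - z))\<^sup>2 \<le> (grad_y f x u - grad_y f x z) \<bullet> (u - z)" for u z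
    by (rule strongly_convex_gradient_mono[OF strong(2)[OF x] fy[OF x]])
  show "(hess_yy f x y *v u) \<bullet> w = u \<bullet> (hess_yy f x y *v w)" for y u w
  proof (rule derivative_symmetric_of_gradient[OF fy[OF x]])
    have "((\<lambda>y'. (x, y')) has_derivative (\<lambda>d. (0, d))) (at y)"
      by (auto intro!: derivative_eq_intros)
    from has_derivative_compose[OF this G]
    show "(grad_y f x has_derivative (\<lambda>w. hess_yy f x y *v w)) (at y)" by simp
  qed
  show "grad_y f x (y_star f x) = 0"
    unfolding y_star_def by (rule gradient_arg_min_eq_0[OF strong(2)[OF x] strong(1) fy[OF x]])
  show "((\<lambda>z. F (fst z) (snd z)) has_derivative
      (\<lambda>d. grad_x F x y \<bullet> fst d + grad_y F x y \<bullet> snd d)) (at (x, y))" for y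
    using gradient_has_derivative[OF Fd[OF x], of y]
    unfolding gradient_prod(1)[OF Fd[OF x]] by (simp add: inner_prod_def case_prod_unfold)
  show "norm (grad_y F x y) \<le> C_Fy" for y by (rule C_Fy[OF x])
  fix x' assume x': "x' \<in> X"
  fix y y'
  show "norm (grad_y f x y - grad_y f x' y') \<le> L_fy * (norm (x - x') + norm (y - y'))"
    using lipschitz_on_prodD[OF L_fy x x'] by simp
  show "norm (grad_y F x y - grad_y F x' y') \<le> L_Fy * (norm (x - x') + norm (y - y'))"
    using lipschitz_on_prodD[OF L_Fy x x'] by simp
  show "norm (grad_x F x y - grad_x F x' y') \<le> LP * (norm (x - x') + norm (y - y'))"
    using lipschitz_on_prodD[OF F_lip x x', of y y']
      norm_fst_le[of "grad_x F x y - grad_x F x' y'" "grad_y F x y - grad_y F x' y'"]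
    by (simp add: gradient_prod(1) Fd x x')
  show "norm (hess_yy f x y *v w - hess_yy f x' y' *v w)
      \<le> L_fyy * (norm (x - x') + norm (y - y')) * norm w" for w
  proof -
    have "norm ((hess_yy f x y - hess_yy f x' y') *v w)
        \<le> onorm (\<lambda>v. (hess_yy f x y - hess_yy f x' y') *v v) * norm w"
      by (intro onorm matrix_vector_mul_bounded_linear)
    also have "\<dots> \<le> (L_fyy * dist (x, y) (x', y')) * norm w"
      using L_fyy x x' unfolding lipschitz_matrix_on_def
      by (intro mult_right_mono) (auto simp: split_beta)
    also have "\<dots> \<le> L_fyy * (norm (x - x') + norm (y - y')) * norm w"
      by (intro mult_right_mono mult_left_mono dist_le LH0) auto
    finally show ?thesis by (simp add: matrix_vector_mult_diff_rdistrib)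
  qed
  show "norm (transpose (hess_xy f x y) *v d - transpose (hess_xy f x' y') *v d)
      \<le> LJ * (norm (x - x') + norm (y - y')) * norm d" for d
  proof -
    let ?D = "\<lambda>d. second_deriv (case_prod f) (x, y) d - second_deriv (case_prod f) (x', y') d"
    have "bounded_linear (second_deriv (case_prod f) z)" if "z \<in> X \<times> UNIV" for z
      using f_C2 that unfolding C2_on_def second_deriv_def
      by (metis frechet_derivative_works has_derivative_bounded_linear)
    then have D: "bounded_linear ?D" using x x' by (intro bounded_linear_sub) auto
    have "norm (transpose (hess_xy f x y) *v d - transpose (hess_xy f x' y') *v d)
        = norm (snd (?D (d, 0)))"
      using x x' by (simp only: second_deriv_grad_y(2)[OF f_C2] snd_diff mem_Times_iff fst_conv UNIV_I snd_conv)
    also have "\<dots> \<le> norm (?D (d, 0))" by (metis norm_snd_le prod.collapse)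
    also have "\<dots> \<le> onorm ?D * norm (d, 0 :: real^'n2)" by (rule onorm[OF D])
    also have "\<dots> \<le> (LJ * dist (x, y) (x', y')) * norm d"
      using f_lip2 x x' unfolding lipschitz_second_deriv_on_def
      by (intro mult_mono) (auto simp: norm_Pair)
    also have "\<dots> \<le> LJ * (norm (x - x') + norm (y - y')) * norm d"
      by (intro mult_right_mono mult_left_mono dist_le LJ0) auto
    finally show ?thesis .
  qed
qed

theorem theorem3p9:
  fixes X :: "(real^'n1) set"
    and f :: "real^'n1 \<Rightarrow> real^'n2 \<Rightarrow> real"
    and F :: "'m::finite \<Rightarrow> real^'n1 \<Rightarrow> real^'n2 \<Rightarrow> real"
    and g :: "'m \<Rightarrow> real^'n1 \<Rightarrow> real"
    and \<O> :: "(real^'n1) set"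
    and \<mu> C_Fy L_Fy L_fy L_fyy :: real
  assumes X: "closed X" "convex X"
    and strong: "\<mu> > 0" "\<And>x. x \<in> X \<Longrightarrow> strongly_convex \<mu> (f x)"
    and f_C2: "C2_on (case_prod f) (X \<times> UNIV)"
    and f_lip1: "\<exists>L. L-lipschitz_on (X \<times> UNIV) (gradient (case_prod f))"
    and f_lip2: "\<exists>L. lipschitz_second_deriv_on L (X \<times> UNIV) (case_prod f)"
    and F_C1: "\<And>i. C1_on (case_prod (F i)) (X \<times> UNIV)"
    and F_below: "\<And>i. bdd_below (case_prod (F i) ` (X \<times> UNIV))"
    and F_lip: "\<And>i. \<exists>L. L-lipschitz_on (X \<times> UNIV) (gradient (case_prod (F i)))"
    and F_bdd: "\<And>i. bounded (gradient (case_prod (F i)) ` (X \<times> UNIV))"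
    and O: "open \<O>" "X \<subseteq> \<O>"
    and g: "\<And>i. convex_on \<O> (g i)" "\<And>i. continuous_on \<O> (g i)"
    and C_Fy: "\<And>i x y. x \<in> X \<Longrightarrow> norm (grad_y (F i) x y) \<le> C_Fy"
    and L_Fy: "\<And>i. L_Fy-lipschitz_on (X \<times> UNIV) (\<lambda>(x, y). grad_y (F i) x y)"
    and L_fy: "L_fy-lipschitz_on (X \<times> UNIV) (\<lambda>(x, y). grad_y f x y)"
    and L_fyy: "lipschitz_matrix_on L_fyy (X \<times> UNIV) (\<lambda>(x, y). hess_yy f x y)"
  shows "\<exists>c\<^sub>\<eta>>0. \<forall>\<beta>. 0 < \<beta> \<and> \<beta> \<le> 2 / (\<mu> + L_fy) \<longrightarrow>
    (\<exists>c\<^sub>\<alpha>>0. \<forall>\<alpha> \<eta> x y v p r.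
        0 < \<alpha> \<and> 0 < \<eta> \<and>
        \<alpha> \<le> c\<^sub>\<alpha> \<and>
        \<alpha> \<le> \<mu> / (4 * L_fy\<^sup>2) * \<eta> \<and>
        (L_v \<mu> C_Fy L_Fy L_fy L_fyy \<noteq> 0 \<longrightarrow>
           \<alpha> \<le> \<mu> ^ 7 / (16 * (L_v \<mu> C_Fy L_Fy L_fy L_fyy)\<^sup>2) * \<eta>) \<and>
        \<eta> \<le> c\<^sub>\<eta> \<and>
        gMOBA X f F g (\<lambda>_. \<alpha>) \<beta> (\<lambda>_. \<eta>) x y v \<and>
        strict_mono r \<and> (x \<circ> r) \<longlonglongrightarrow> p
      \<longrightarrow> pareto_stationary X f F g p)"
proof (cases "X = {}")
  case True
  then show ?thesis by (intro exI[of _ 1]) (auto simp: gMOBA_def intro!: exI[of _ 1])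
next
  case False
  obtain LJ where LJ: "lipschitz_second_deriv_on LJ (X \<times> UNIV) (case_prod f)"
    using f_lip2 by blast
  obtain LF where LF: "\<And>i. (LF i)-lipschitz_on (X \<times> UNIV) (gradient (case_prod (F i)))"
    using F_lip by metis
  \<comment> \<open>One Lipschitz constant for all objectives: then the bounds on the step sizes obtained for a
    single objective are the same for all of them, and \<open>i0\<close> below is immaterial.\<close>
  define LP where "LP = (\<Sum>i\<in>UNIV. LF i)"
  have LP: "LP-lipschitz_on (X \<times> UNIV) (gradient (case_prod (F i)))" for i
    unfolding LP_def using lipschitz_on_nonneg[OF LF]
    by (intro lipschitz_on_le[OF LF[of i]] member_le_sum) auto
  define H where "H x y w = hess_yy f x y *v w" for x y w
  define J where "J x y d = transpose (hess_xy f x y) *v d" for x y d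
  have bil: "bilevel_objective X (grad_y f) H J (y_star f) (F i) (grad_x (F i)) (grad_y (F i))
      \<mu> L_fy L_fyy LJ LP L_Fy C_Fy" for i
    unfolding H_def[abs_def] J_def[abs_def]
    by (intro bilevel_objective_standing X False strong f_C2 LJ F_C1 LP C_Fy L_Fy L_fy L_fyy)
  obtain i0 :: 'm where True by simp
  interpret B: bilevel_objective X "grad_y f" H J "y_star f" "F i0" "grad_x (F i0)" "grad_y (F i0)"
      \<mu> L_fy L_fyy LJ LP L_Fy C_Fy by (rule bil)
  let ?Lv = "L_v \<mu> C_Fy L_Fy L_fy L_fyy"
  \<comment> \<open>Turns the bound on \<open>\<alpha>\<close> through \<open>L_v\<close> into the one required by the Lyapunov estimate.\<close>
  have LV: "B.LV = ?Lv / \<mu> ^ 3"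
    using strong(1) by (simp add: B.LV_def B.K_def L_v_def power2_eq_square power3_eq_cube field_simps)
  have gX: "continuous_on X (g i)" for i using g(2) O(2) by (rule continuous_on_subset)
  show ?thesis
  proof (rule exI[of _ "2 / (\<mu> + L_fy)"], intro conjI allI impI)
    show "0 < 2 / (\<mu> + L_fy)" using strong(1) B.nonneg by (simp add: add_pos_nonneg)
    fix \<beta> assume \<beta>: "0 < \<beta> \<and> \<beta> \<le> 2 / (\<mu> + L_fy)"
    show "\<exists>c\<^sub>\<alpha>>0. \<forall>\<alpha> \<eta> x y v p r.
        0 < \<alpha> \<and> 0 < \<eta> \<and> \<alpha> \<le> c\<^sub>\<alpha> \<and> \<alpha> \<le> \<mu> / (4 * L_fy\<^sup>2) * \<eta> \<and>
        (?Lv \<noteq> 0 \<longrightarrow> \<alpha> \<le> \<mu> ^ 7 / (16 * ?Lv\<^sup>2) * \<eta>) \<and>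
        \<eta> \<le> 2 / (\<mu> + L_fy) \<and> gMOBA X f F g (\<lambda>_. \<alpha>) \<beta> (\<lambda>_. \<eta>) x y v \<and>
        strict_mono r \<and> (x \<circ> r) \<longlonglongrightarrow> p \<longrightarrow> pareto_stationary X f F g p"
    proof (rule exI[of _ "B.alpha_bound \<beta>"], intro conjI allI impI, goal_cases)
      case 1
      show ?case using B.alpha_bound_pos \<beta> by blast
    next
      case (2 \<alpha> \<eta> x y v p r)
      then have \<alpha>: "0 < \<alpha>" "\<alpha> \<le> B.alpha_bound \<beta>" "\<alpha> \<le> \<mu> / (4 * L_fy\<^sup>2) * \<eta>"
        and \<alpha>Lv: "?Lv \<noteq> 0 \<Longrightarrow> \<alpha> \<le> \<mu> ^ 7 / (16 * ?Lv\<^sup>2) * \<eta>"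
        and \<eta>: "0 < \<eta>" "\<eta> \<le> 2 / (\<mu> + L_fy)"
        and moba: "gMOBA X f F g (\<lambda>_. \<alpha>) \<beta> (\<lambda>_. \<eta>) x y v"
        and r: "strict_mono r" "(x \<circ> r) \<longlonglongrightarrow> p" by blast+
      have \<alpha>LV: "\<alpha> \<le> \<mu> / (16 * B.LV\<^sup>2) * \<eta>" if "B.LV \<noteq> 0"
      proof -
        have "?Lv \<noteq> 0" using that by (auto simp: LV)
        moreover have "\<mu> / (16 * B.LV\<^sup>2) = \<mu> ^ 7 / (16 * ?Lv\<^sup>2)"
          using strong(1) unfolding LV by (simp add: power_divide field_simps power_mult[symmetric] eval_nat_numeral)
        ultimately show ?thesis using \<alpha>Lv by simp
      qed
      define e where "e i k d = d_phi f (F i) (x k) (y k) (v k i) \<bullet> d" for i k d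
      define obj where "obj k u = Max (range (\<lambda>i. e i k (u - x k) + g i u - g i (x k)))
          + 1 / (2 * \<alpha>) * (norm (u - x k))\<^sup>2" for k u
      have step: "x 0 \<in> X" "is_arg_min (obj k) (\<lambda>u. u \<in> X) (x (Suc k))"
        "y (Suc k) = y k - \<beta> *\<^sub>R grad_y f (x k) (y k)"
        "v (Suc k) i = v k i - \<eta> *\<^sub>R (H (x k) (y k) (v k i) - grad_y (F i) (x k) (y k))" for k i
        using moba by (simp_all add: gMOBA_def obj_def[abs_def] e_def d_v_def H_def)
      have xX: "x k \<in> X" for k
        using step(1) step(2)[of "k - 1"] by (cases k) (auto simp: is_arg_min_def)
      have opt: "obj k (x (Suc k)) \<le> obj k u" if "u \<in> X" for k u
        using step(2)[of k] that by (auto simp: is_arg_min_def not_less)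
      have p: "p \<in> X" using closed_sequentially[OF X(1) _ r(2)] xX by simp
      have E: "bilevel_objective.E J (grad_x (F i)) (x k) (y k) (v k i) = e i k" for i k
        by (simp add: fun_eq_iff bilevel_objective.E_def[OF bil] e_def d_phi_def J_def
            inner_diff_left inner_matrix_vector_transpose)
      \<comment> \<open>Comparison with \<open>u = x k\<close>, where the proximal model is \<open>0\<close>.\<close>
      have prox: "e i k (x (Suc k) - x k) + g i (x (Suc k)) - g i (x k)
          \<le> - (norm (x (Suc k) - x k))\<^sup>2 / (2 * \<alpha>)" for i k
      proof -
        have "e i k (x (Suc k) - x k) + g i (x (Suc k)) - g i (x k)
            \<le> Max (range (\<lambda>i. e i k (x (Suc k) - x k) + g i (x (Suc k)) - g i (x k)))"
          by (rule Max_ge) auto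
        moreover have "obj k (x (Suc k)) \<le> 0"
          using opt[OF xX, of k k] by (simp add: obj_def e_def)
        ultimately have "e i k (x (Suc k) - x k) + g i (x (Suc k)) - g i (x k)
            + 1 / (2 * \<alpha>) * (norm (x (Suc k) - x k))\<^sup>2 \<le> 0"
          unfolding obj_def by linarith
        then show ?thesis by simp
      qed
      define D where
        "D i = bilevel_objective.dphi H J (y_star f) (grad_x (F i)) (grad_y (F i)) p" for i
      have D: "((\<lambda>x. F i x (y_star f x)) has_derivative D i) (at p within X)" for i
        using bilevel_objective.phi_has_derivative[OF bil p, of i]
        unfolding D_def by (simp add: bilevel_objective.phi_def[OF bil, abs_def])
      have x': "(\<lambda>k. x (Suc (r k))) \<longlonglongrightarrow> p"
        by (rule bilevel_objective.limit_point_estimates(1)[OF bil[of i0], where x=x and y=y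
              and w="\<lambda>k. v k i0" and g="g i0" and \<alpha>=\<alpha> and \<beta>=\<beta> and \<eta>=\<eta> and r=r])
           (use xX \<beta> \<eta> \<alpha> \<alpha>LV prox step(3,4) r p gX in \<open>auto simp: E\<close>)
      have lim: "(\<lambda>k. e i (r k) (d k)) \<longlonglongrightarrow> D i d0" if "d \<longlonglongrightarrow> d0" for i d d0
        unfolding D_def E[symmetric]
        by (rule bilevel_objective.limit_point_estimates(2)[OF bil, where x=x and y=y
              and w="\<lambda>k. v k i" and g="g i" and \<alpha>=\<alpha> and \<beta>=\<beta> and \<eta>=\<eta> and r=r])
           (use that xX \<beta> \<eta> \<alpha> \<alpha>LV prox step(3,4) r p gX in \<open>auto simp: E\<close>)
      show ?case
      proof (rule pareto_stationaryI_proximal[where D=D and S=\<O> and c="1 / (2 * \<alpha>)"])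
        show "convex X" "p \<in> X" "open \<O>" "X \<subseteq> \<O>" by fact+
        show "((\<lambda>x. F i x (y_star f x)) has_derivative D i) (at p within X)" "convex_on \<O> (g i)" for i
          by (rule D g(1))+
        show "0 \<le> 1 / (2 * \<alpha>)" using \<alpha>(1) by simp
        fix u assume u: "u \<in> X"
        show "\<exists>j. 0 \<le> D j (u - p) + g j u - g j p + 1 / (2 * \<alpha>) * (norm (u - p))\<^sup>2"
        proof (rule proximal_optimality_limit[where x="\<lambda>k. x (r k)" and x'="\<lambda>k. x (Suc (r k))"
              and e="\<lambda>i k. e i (r k)" and D=D, OF _ _ xX _ xX x' lim _ gX p u])
          show "D i 0 = 0" for i by (rule linear_0[OF has_derivative_linear[OF D]])
        qed (use opt \<alpha>(1) r(2) in \<open>auto simp: obj_def o_def\<close>)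
      qed
    qed
  qed
qed

end
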